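(* Let $\delta\in(0,1)$. Let $P(t)$, $t\ge0$, be a homogeneous Poisson process with unit intensity, let $U_1\le U_2\le\ldots$ be an infinitely increasing sequence of nonnegative random variables, each independent of the process $P$, and let $N_k=P(U_k)$, $k\ge1$. Let $X_1,X_2,\ldots$ be independent identically distributed random variables with common distribution function $F(x)=\mathsf{P}(X_i<x)$ such that for each $k$ the random variable $N_k$ is independent of the sequence $X_1,X_2,\ldots$. For the existence of numbers $a_k\in\mathbb{R}$ and $b_k>0$ such that $$\frac{1}{b_k}\Big(\min_{1\le j\le N_k}X_j-a_k\Big)\Longrightarrow M_\delta\quad(k\to\infty)$$ it is sufficient that: (i) there exists $\delta'\in(\delta,1]$ such that $F$ belongs to the domain of min-attraction of the Weibull distribution with shape parameter $\delta'$, that is, $\mathrm{lext}(F)>-\infty$ and the function $A_F(x)=F\big(\mathrm{lext}(F)-x^{-1}\big)$ satisfies, for any $x>0$, $$\lim_{y\to-\infty}\frac{A_F(yx)}{A_F(y)}=x^{-\delta'};$$ (ii) there exists a sequence of positive numbers $\{d_k\}_{k\ge1}$ increasing to infinity such that $$\frac{U_k}{d_k}\Longrightarrow S_{\delta',1}^{-\delta'}K_{\delta/\delta'}^{\delta'/\delta}\quad(k\to\infty),$$ where the random variables $S_{\delta',1}$ and $K_{\delta/\delta'}$ are independent. Moreover, the numbers $a_k$ and $b_k$ can be defined as $$a_k=\mathrm{lext}(F),\qquad b_k=\sup\{x:\ F(x)\le d_k^{-1}\}-\mathrm{lext}(F),\qquad k\ge1.$$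
   Context: $\mathrm{lext}(F)=\inf\{x:F(x)>0\}$. $\Longrightarrow$ denotes convergence in distribution. The minimum over an empty index set (when $N_k=0$) is given the value $0$. For $\delta\in(0,1]$, $M_\delta$ is a nonnegative random variable with the (standard) Mittag-Leffler distribution, i.e. with Laplace transform $\mathsf{E}e^{-sM_\delta}=1/(1+s^{\delta})$, $s\ge 0$. For $\beta\in(0,1]$, $S_{\beta,1}$ is a nonnegative random variable with the one-sided strictly stable distribution with characteristic exponent $\beta$, i.e. with Laplace transform $\mathsf{E}e^{-sS_{\beta,1}}=e^{-s^{\beta}}$, $s\ge0$ (so $S_{1,1}=1$ almost surely). For $\rho\in(0,1)$, $K_\rho$ is a random variable with probability density $$f^K_\rho(x)=\frac{\sin(\pi\rho)}{\pi\rho\,[x^2+2x\cos(\pi\rho)+1]},\quad x\in(0,\infty).$$ "Infinitely increasing" for the $U_k$ means $U_{k+1}(\omega)\ge U_k(\omega)$ for all $\omega$ and $k$, with $U_k\to\infty$ in probability. *)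

theory Defs
  imports "HOL-Probability.Probability"
begin

(* The library's indep_var requires both random variables to have the same range type. *)
definition independent_rvs ::
  "'a measure \<Rightarrow> 'b measure \<Rightarrow> ('a \<Rightarrow> 'b) \<Rightarrow> 'c measure \<Rightarrow> ('a \<Rightarrow> 'c) \<Rightarrow> bool" where
  "independent_rvs M Ma A Mb B \<longleftrightarrow>
     A \<in> measurable M Ma \<and> B \<in> measurable M Mb \<and>
     prob_space.indep_set M {A -` S \<inter> space M | S. S \<in> sets Ma} {B -` S \<inter> space M | S. S \<in> sets Mb}"

(* The process is indexed by t >= 0; its values at negative times are irrelevant.
   Increments are natural numbers, and subtraction does not truncate because of the monotone paths. *)
definition poisson_process :: "'a measure \<Rightarrow> real \<Rightarrow> (real \<Rightarrow> 'a \<Rightarrow> nat) \<Rightarrow> bool" where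
  "poisson_process M l P \<longleftrightarrow>
     (\<forall>t\<ge>0. P t \<in> measurable M (count_space UNIV)) \<and>
     (\<forall>\<omega>\<in>space M. P 0 \<omega> = 0) \<and>
     (\<forall>\<omega>\<in>space M. \<forall>s t. 0 \<le> s \<and> s \<le> t \<longrightarrow> P s \<omega> \<le> P t \<omega>) \<and>
     (\<forall>\<omega>\<in>space M. \<forall>t\<ge>0. continuous (at_right t) (\<lambda>s. P s \<omega>)) \<and>
     (\<forall>(n::nat) (t::nat \<Rightarrow> real). 0 \<le> t 0 \<and> (\<forall>i<n. t i < t (Suc i)) \<longrightarrow>
        prob_space.indep_vars M (\<lambda>_. count_space UNIV)
          (\<lambda>i \<omega>. P (t (Suc i)) \<omega> - P (t i) \<omega>) {..<n}) \<and>
     (\<forall>s t. 0 \<le> s \<and> s < t \<longrightarrow>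
        distr M (count_space UNIV) (\<lambda>\<omega>. P t \<omega> - P s \<omega>) = measure_pmf (poisson_pmf (l * (t - s))))"

definition process_path :: "(real \<Rightarrow> 'a \<Rightarrow> 'b) \<Rightarrow> 'a \<Rightarrow> real \<Rightarrow> 'b" where
  "process_path P \<omega> = (\<lambda>t\<in>{0..}. P t \<omega>)"

definition converges_in_distribution :: "'a measure \<Rightarrow> (nat \<Rightarrow> 'a \<Rightarrow> real) \<Rightarrow> real measure \<Rightarrow> bool" where
  "converges_in_distribution M Y \<mu> \<longleftrightarrow>
     (\<forall>k. Y k \<in> borel_measurable M) \<and> weak_conv_m (\<lambda>k. distr M borel (Y k)) \<mu>"

definition infinitely_increasing :: "'a measure \<Rightarrow> (nat \<Rightarrow> 'a \<Rightarrow> real) \<Rightarrow> bool" where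
  "infinitely_increasing M U \<longleftrightarrow>
     (\<forall>k. \<forall>\<omega>\<in>space M. U k \<omega> \<le> U (Suc k) \<omega>) \<and>
     (\<forall>c. (\<lambda>k. \<P>(\<omega> in M. U k \<omega> > c)) \<longlonglongrightarrow> 1)"

definition nonneg_law_with_laplace :: "real measure \<Rightarrow> (real \<Rightarrow> real) \<Rightarrow> bool" where
  "nonneg_law_with_laplace \<mu> \<phi> \<longleftrightarrow>
     real_distribution \<mu> \<and> (AE x in \<mu>. 0 \<le> x) \<and> (\<forall>s\<ge>0. (\<integral>x. exp (- s * x) \<partial>\<mu>) = \<phi> s)"

definition mittag_leffler_law :: "real \<Rightarrow> real measure \<Rightarrow> bool" where
  "mittag_leffler_law \<delta> \<mu> \<longleftrightarrow> nonneg_law_with_laplace \<mu> (\<lambda>s. 1 / (1 + s powr \<delta>))"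

definition one_sided_stable_law :: "real \<Rightarrow> real measure \<Rightarrow> bool" where
  "one_sided_stable_law \<beta> \<mu> \<longleftrightarrow> nonneg_law_with_laplace \<mu> (\<lambda>s. exp (- (s powr \<beta>)))"

definition K_density :: "real \<Rightarrow> real \<Rightarrow> real" where
  "K_density \<rho> x =
     (if 0 < x then sin (pi * \<rho>) / (pi * \<rho> * (x\<^sup>2 + 2 * x * cos (pi * \<rho>) + 1)) else 0)"

definition lext :: "(real \<Rightarrow> real) \<Rightarrow> ereal" where
  "lext F = Inf (ereal ` {x. F x > 0})"

definition A_fun :: "(real \<Rightarrow> real) \<Rightarrow> real \<Rightarrow> real" where
  "A_fun F x = F (real_of_ereal (lext F) - 1 / x)"

definition weibull_min_domain :: "real \<Rightarrow> (real \<Rightarrow> real) \<Rightarrow> bool" where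
  "weibull_min_domain \<gamma> F \<longleftrightarrow>
     lext F > - \<infinity> \<and>
     (\<forall>x>0. ((\<lambda>y. A_fun F (y * x) / A_fun F y) \<longlongrightarrow> x powr (- \<gamma>)) at_bot)"

(* The terms of the sample are X 0, ..., X (n - 1). *)
definition sample_min :: "(nat \<Rightarrow> 'a \<Rightarrow> real) \<Rightarrow> nat \<Rightarrow> 'a \<Rightarrow> real" where
  "sample_min X n \<omega> = (if n = 0 then 0 else Min ((\<lambda>j. X j \<omega>) ` {..<n}))"

(* The supremum is infinite when d <= 1, since F <= 1; hence the extended real value. *)
definition min_scale :: "(real \<Rightarrow> real) \<Rightarrow> real \<Rightarrow> ereal" where
  "min_scale F d = Sup (ereal ` {x. F x \<le> 1 / d}) - lext F"

end

theory Submission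
  imports Defs "HOL-Complex_Analysis.Complex_Analysis" "HOL-Real_Asymp.Real_Asymp"
begin

text \<open>
  Let $W = S^{-\<delta>'} K^{\<delta>'/\<delta>}$ be the limit of $U_k/d_k$, with independent $S$ (stable of index
  $\<delta>'$) and $K$ (of the law $K_\<rho>$, $\<rho> = \<delta>/\<delta>'$), and let $a$ be the left endpoint of $F$.
  
  Given $U_k$, the sample size $N_k$ is Poisson with mean $U_k$, so that all terms of the sample are at least
  $y$ with probability $E (1-F(y))^{N_k} = E e^{-U_k F(y)}$ (\<open>prob_poisson_sample_ge\<close>).
  At $y = a + b_k x$ the exponent is the product of $U_k/d_k$, which converges to $W$ in law, and of
  $d_k F(a + b_k x)$, which converges to $x^{\<delta>'}$: the scale $b_k$ is a quantile of $F$ at level $1/d_k$,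
  and $F$ is regularly varying at $a$ with index $\<delta>'$ (\<open>min_scale_normalizes\<close>). Hence the
  normalised minimum exceeds $x > 0$ with a probability that tends to $E exp(-x^{\<delta>'} W)$.
  
  It remains to recognise this function as the tail of the Mittag-Leffler law
  (\<open>mittag_leffler_cdf\<close>). It is the tail of $Y = S T^{1/\<delta>'} K^{-1/\<delta>}$ with a standard
  exponential $T$ independent of $(S,K)$. The Laplace transform of $Y$ at $s$ is the mean of
  $1/(1 + s^{\<delta>'} K^{-1/\<rho>})$, and a contour integral evaluates this mean to $1/(1+s^\<delta>)$
  (\<open>K_density_stieltjes_transform\<close>). A law on the half-line is determined by its Laplace transform
  (\<open>nonneg_law_eqI_laplace\<close>), so $Y$ has the Mittag-Leffler law.
\<close>

section \<open>The Stieltjes transform of the law of $K_\<rho>$\<close>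

text \<open>
  The contour integral behind the law of $K_\<rho>$ lives in logarithmic coordinates.
  On the lines $Im w = \<plusminus>\<pi>$ the factor $1 - v e^{-w}$ equals $1 + v e^{-t}$, and
  the jump of $1 / (1 + e^{\<rho> w})$ between these lines is, up to a constant, $x f(x)$ at
  $x = e^{\<rho> t}$, where $f$ is the density of $K_\<rho>$. Inside the strip there is a single simple pole, at $w = ln v$.
\<close>

definition strip_kernel :: "real \<Rightarrow> real \<Rightarrow> complex \<Rightarrow> complex" where
  "strip_kernel \<rho> v w = 1 / ((1 + exp (of_real \<rho> * w)) * (1 - of_real v * exp (- w)))"

text \<open>
  The largest open horizontal strip on which the pole at $ln v$ is the only singularity: the zeros of
  $1 + e^{\<rho> w}$ have $|Im w| \<ge> \<pi>/\<rho>$, and the further zeros of $1 - v e^{-w}$ have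
  $|Im w| \<ge> 2\<pi>$. As $\<rho> < 1$, it contains the closed strip $|Im w| \<le> \<pi>$.
\<close>

definition closed_strip_neighbourhood :: "real \<Rightarrow> complex set" where
  "closed_strip_neighbourhood \<rho> = {w. \<bar>Im w\<bar> < pi / \<rho>} \<inter> {w. \<bar>Im w\<bar> < 2 * pi}"

lemma mem_closed_strip_neighbourhood:
  assumes "0 < \<rho>" "\<rho> < 1" and "\<bar>Im w\<bar> \<le> pi"
  shows "w \<in> closed_strip_neighbourhood \<rho>"
proof -
  have "pi < pi / \<rho>" using assms by (simp add: field_simps)
  moreover have "pi < 2 * pi" by simp
  ultimately have "\<bar>Im w\<bar> < pi / \<rho>" "\<bar>Im w\<bar> < 2 * pi" using assms(3) by linarith+
  then show ?thesis by (simp add: closed_strip_neighbourhood_def)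
qed

lemma strip_kernel_zeros:
  assumes \<rho>: "0 < \<rho>" and v: "0 < v" and w: "w \<in> closed_strip_neighbourhood \<rho>"
  shows "1 + exp (of_real \<rho> * w) \<noteq> 0"
    and "1 - of_real v * exp (- w) = 0 \<longleftrightarrow> w = of_real (ln v)"
proof -
  show "1 + exp (of_real \<rho> * w) \<noteq> 0"
  proof
    assume "1 + exp (of_real \<rho> * w) = 0"
    then have e: "exp (of_real \<rho> * w) = exp (\<i> * pi)"
      by (simp add: add_eq_0_iff)
    then obtain n :: int where "of_real \<rho> * w = \<i> * pi + (of_int (2 * n) * pi) * \<i>"
      unfolding exp_eq by blast
    then have im: "\<rho> * Im w = (1 + 2 * real_of_int n) * pi"
      by (auto simp: complex_eq_iff algebra_simps)
    have "\<rho> * \<bar>Im w\<bar> < pi"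
      using w \<rho> by (simp add: closed_strip_neighbourhood_def field_simps)
    then have "\<bar>1 + 2 * real_of_int n\<bar> * pi < 1 * pi"
      using arg_cong[OF im, of abs] \<rho> by (simp add: abs_mult)
    then have "\<bar>1 + 2 * real_of_int n\<bar> < 1" by simp
    then have "\<bar>1 + 2 * n\<bar> < 1" by linarith
    then show False by presburger
  qed
  show "1 - of_real v * exp (- w) = 0 \<longleftrightarrow> w = of_real (ln v)"
  proof
    assume "1 - of_real v * exp (- w) = 0"
    then have "exp w = of_real v"
      by (simp add: exp_minus field_simps)
    also have "\<dots> = exp (of_real (ln v))"
      using v by (subst exp_of_real) simp
    finally obtain n :: int where n: "w = of_real (ln v) + (of_int (2 * n) * pi) * \<i>"
      unfolding exp_eq by blast
    then have im: "Im w = 2 * real_of_int n * pi" by simp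
    then have "\<bar>2 * real_of_int n\<bar> * pi < 2 * pi"
      using w by (simp add: closed_strip_neighbourhood_def abs_mult)
    then have "n = 0" by simp
    with n show "w = of_real (ln v)" by simp
  next
    assume "w = of_real (ln v)"
    moreover have "exp (- complex_of_real (ln v)) = 1 / of_real v"
      using v by (simp add: exp_minus field_simps exp_of_real)
    ultimately show "1 - of_real v * exp (- w) = 0" using v by simp
  qed
qed

text \<open>
  The residue at $ln v$ is $1 / (1 + e^{\<rho> ln v})$, because $1 - v e^{-w}$ has derivative $1$ there.
\<close>

lemma strip_kernel_contour_integral:
  assumes \<rho>: "0 < \<rho>" "\<rho> < 1" and v: "0 < v" and R: "\<bar>ln v\<bar> < R"
  shows "contour_integral (rectpath (Complex (-R) (-pi)) (Complex R pi)) (strip_kernel \<rho> v)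
         = 2 * pi * \<i> * complex_of_real (1 / (1 + v powr \<rho>))"
proof -
  let ?z = "complex_of_real (ln v)" and ?S = "closed_strip_neighbourhood \<rho>"
  let ?g = "rectpath (Complex (-R) (-pi)) (Complex R pi)"
  have S: "open ?S" "convex ?S"
  proof -
    have *: "{w. \<bar>Im w\<bar> < c} = Im -` {-c<..<c}" for c by auto
    show "open ?S" unfolding closed_strip_neighbourhood_def *
      by (intro open_Int continuous_open_vimage open_greaterThanLessThan continuous_intros)
    have "linear Im" by (rule bounded_linear.linear[OF bounded_linear_Im])
    then show "convex ?S" unfolding closed_strip_neighbourhood_def *
      by (intro convex_Int convex_linear_vimage) auto
  qed
  have z: "?z \<in> ?S" using \<rho> by (simp add: closed_strip_neighbourhood_def)
  have holo: "strip_kernel \<rho> v holomorphic_on ?S - {?z}"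
    unfolding strip_kernel_def
    using strip_kernel_zeros[OF \<rho>(1) v] by (intro holomorphic_intros) auto
  have rect: "w \<in> ?S" if "Im w \<in> {-pi..pi}" for w
    using that by (intro mem_closed_strip_neighbourhood[OF \<rho>]) auto
  have path: "path_image ?g \<subseteq> ?S - {?z}"
    using R by (subst path_image_rectpath) (auto intro: rect)
  have wind: "winding_number ?g ?z = 1"
    using R by (intro winding_number_rectpath) (auto simp: in_box_complex_iff)
  have wind0: "winding_number ?g w = 0" if "w \<notin> ?S" for w
    using R that rect[of w]
    by (intro winding_number_rectpath_outside) (auto simp: in_cbox_complex_iff)
  have res: "residue (strip_kernel \<rho> v) ?z = complex_of_real (1 / (1 + v powr \<rho>))"
  proof (rule residue_simple'[OF S(1) z holo])
    have ev: "complex_of_real v * exp (- ?z) = 1"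
      using v by (simp add: exp_minus exp_of_real)
    have "((\<lambda>w. 1 - of_real v * exp (- w)) has_field_derivative 1) (at ?z)"
      using ev by (auto intro!: derivative_eq_intros simp: mult.commute)
    then have "((\<lambda>w. (1 - of_real v * exp (- w)) / (w - ?z)) \<longlongrightarrow> 1) (at ?z)"
      unfolding has_field_derivative_iff using ev by simp
    then have "((\<lambda>w. inverse ((1 - of_real v * exp (- w)) / (w - ?z))) \<longlongrightarrow> inverse 1) (at ?z)"
      by (rule tendsto_inverse) simp
    then have l1: "((\<lambda>w. (w - ?z) / (1 - of_real v * exp (- w))) \<longlongrightarrow> 1) (at ?z)"
      by simp
    have "((\<lambda>w. 1 / (1 + exp (of_real \<rho> * w))) \<longlongrightarrow> 1 / (1 + exp (of_real \<rho> * ?z))) (at ?z)"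
      using strip_kernel_zeros(1)[OF \<rho>(1) v z] by (intro tendsto_intros) auto
    from tendsto_mult[OF this l1]
    have "((\<lambda>w. strip_kernel \<rho> v w * (w - ?z)) \<longlongrightarrow> 1 / (1 + exp (of_real \<rho> * ?z))) (at ?z)"
      by (simp add: strip_kernel_def)
    moreover have "exp (of_real \<rho> * ?z) = complex_of_real (v powr \<rho>)"
      using v by (simp add: powr_def exp_of_real flip: of_real_mult)
    ultimately show "((\<lambda>w. strip_kernel \<rho> v w * (w - ?z)) \<longlongrightarrow> complex_of_real (1 / (1 + v powr \<rho>))) (at ?z)"
      by simp
  qed
  have "contour_integral ?g (strip_kernel \<rho> v)
        = 2 * pi * \<i> * (\<Sum>p\<in>{?z}. winding_number ?g p * residue (strip_kernel \<rho> v) p)"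
    using S holo path wind0
    by (intro Residue_theorem) (auto intro: convex_connected)
  then show ?thesis using wind res by simp
qed

text \<open>
  The two values of $1 / (1 + e^{\<rho> w})$ are complex conjugates, so their difference is purely
  imaginary; it is this imaginary part that reproduces the density of $K_\<rho>$.
\<close>

lemma strip_kernel_horizontal:
  fixes t :: real
  shows "strip_kernel \<rho> v (Complex t (-pi)) - strip_kernel \<rho> v (Complex t pi)
     = \<i> * of_real (2 * sin (pi * \<rho>) * exp (\<rho> * t) /
         ((exp (\<rho> * t) ^ 2 + 2 * exp (\<rho> * t) * cos (pi * \<rho>) + 1) * (1 + v * exp (- t))))"
proof -
  define a where "a = exp (\<rho> * t) * cos (pi * \<rho>)"
  define b where "b = exp (\<rho> * t) * sin (pi * \<rho>)"
  have sq: "(1 + a)\<^sup>2 + b\<^sup>2 = exp (\<rho> * t) ^ 2 + 2 * exp (\<rho> * t) * cos (pi * \<rho>) + 1"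
    unfolding a_def b_def power_mult_distrib sin_squared_eq by (simp add: algebra_simps power2_eq_square)
  have e: "exp (of_real \<rho> * Complex t pi) = Complex a b"
     "exp (of_real \<rho> * Complex t (-pi)) = Complex a (-b)"
    by (simp_all add: a_def b_def complex_eq_iff Re_exp Im_exp mult.commute)
  have e2: "exp (- Complex t pi) = - of_real (exp (- t))"
     "exp (- Complex t (-pi)) = - of_real (exp (- t))"
    by (simp_all add: complex_eq_iff Re_exp Im_exp)
  have d: "1 / (1 + Complex a (-b)) - 1 / (1 + Complex a b) = \<i> * of_real (2 * b / ((1 + a)\<^sup>2 + b\<^sup>2))"
    by (simp add: complex_eq_iff Re_divide Im_divide) (simp add: power2_eq_square)
  have "strip_kernel \<rho> v (Complex t (-pi)) - strip_kernel \<rho> v (Complex t pi)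
        = (1 / (1 + Complex a (-b)) - 1 / (1 + Complex a b)) / of_real (1 + v * exp (- t))"
    unfolding strip_kernel_def e e2 by (simp add: diff_divide_distrib)
  also have "\<dots> = \<i> * of_real (2 * b / (((1 + a)\<^sup>2 + b\<^sup>2) * (1 + v * exp (- t))))"
    unfolding d by simp
  finally show ?thesis unfolding sq by (simp add: b_def mult_ac)
qed

lemma K_density_denominator_pos:
  assumes \<rho>: "0 < \<rho>" "\<rho> < 1"
  shows "0 < x\<^sup>2 + 2 * x * cos (pi * \<rho>) + 1"
proof -
  have "0 < sin (pi * \<rho>)" using \<rho> by (intro sin_gt_zero) auto
  moreover have "(x + cos (pi * \<rho>))\<^sup>2 + (sin (pi * \<rho>))\<^sup>2 = x\<^sup>2 + 2 * x * cos (pi * \<rho>) + 1"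
    unfolding sin_squared_eq by (simp add: power2_eq_square algebra_simps)
  moreover have "0 < (x + cos (pi * \<rho>))\<^sup>2 + (sin (pi * \<rho>))\<^sup>2"
    using \<open>0 < sin (pi * \<rho>)\<close> by (intro add_nonneg_pos) auto
  ultimately show ?thesis by simp
qed

lemma K_density_nonneg: "0 < \<rho> \<Longrightarrow> \<rho> < 1 \<Longrightarrow> 0 \<le> K_density \<rho> x"
  using K_density_denominator_pos[of \<rho> x] sin_ge_zero[of "pi * \<rho>"]
  by (simp add: K_density_def)

lemma K_density_measurable [measurable]: "K_density \<rho> \<in> borel_measurable borel"
  unfolding K_density_def by measurable

text \<open>
  Integrating over the rectangle with vertices $\<plusminus>R \<plusminus> i\<pi>$, the horizontal sides give $2\<pi>i$ times
  the truncated integral, and the right-hand side bounds the contribution of the vertical sides: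
  on the right one $1 / (1 + e^{\<rho> w})$ is small, on the left one $1 / (1 - v e^{-w})$ is.
\<close>

lemma K_density_truncated_integral:
  assumes \<rho>: "0 < \<rho>" "\<rho> < 1" and v: "0 < v" and R: "\<bar>ln v\<bar> < R" "0 < R"
  defines "k \<equiv> \<lambda>x. K_density \<rho> x / (1 + v * x powr (- 1 / \<rho>))"
  shows "k integrable_on {exp (- \<rho> * R)..exp (\<rho> * R)}"
    and "\<bar>integral {exp (- \<rho> * R)..exp (\<rho> * R)} k - 1 / (1 + v powr \<rho>)\<bar>
         \<le> 1 / ((exp (\<rho> * R) - 1) * (1 - v * exp (- R)))
           + 1 / ((1 - exp (- \<rho> * R)) * (v * exp R - 1))"
proof -
  let ?J = "{exp (- \<rho> * R)..exp (\<rho> * R)}" and ?\<phi> = "strip_kernel \<rho> v"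
  define B1 where "B1 = 1 / ((exp (\<rho> * R) - 1) * (1 - v * exp (- R)))"
  define B2 where "B2 = 1 / ((1 - exp (- \<rho> * R)) * (v * exp R - 1))"
  note den = K_density_denominator_pos[OF \<rho>]
  have pos: "0 < x" if "x \<in> ?J" for x
    using that less_le_trans[OF exp_gt_zero] by auto
  have cont: "continuous_on ?J k"
  proof -
    have "continuous_on ?J (\<lambda>x. sin (pi * \<rho>) / (pi * \<rho> * (x\<^sup>2 + 2 * x * cos (pi * \<rho>) + 1))
              / (1 + v * x powr (- 1 / \<rho>)))"
    proof (intro continuous_intros ballI)
      fix x assume x: "x \<in> ?J"
      show "pi * \<rho> * (x\<^sup>2 + 2 * x * cos (pi * \<rho>) + 1) \<noteq> 0" using den[of x] \<rho> by simp
      show "x \<noteq> 0" using pos[OF x] by simp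
      have "0 < 1 + v * x powr (- 1 / \<rho>)" using v by (intro add_pos_nonneg) auto
      then show "1 + v * x powr (- 1 / \<rho>) \<noteq> 0" by simp
    qed
    moreover have "k x = sin (pi * \<rho>) / (pi * \<rho> * (x\<^sup>2 + 2 * x * cos (pi * \<rho>) + 1))
              / (1 + v * x powr (- 1 / \<rho>))" if "x \<in> ?J" for x
      using pos[OF that] by (simp add: k_def K_density_def)
    ultimately show ?thesis by (metis (no_types, lifting) continuous_on_eq)
  qed
  then show "k integrable_on ?J" by (rule integrable_continuous_real)
  \<comment> \<open>The parameter of a horizontal side runs over the unit interval; the substitution x = exp (\<rho> * t s) matches it with the density.\<close>
  define t where "t s = 2 * R * s - R" for s :: real
  define \<psi> where "\<psi> s = 2 * R * (2 * sin (pi * \<rho>) * exp (\<rho> * t s) /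
         ((exp (\<rho> * t s) ^ 2 + 2 * exp (\<rho> * t s) * cos (pi * \<rho>) + 1) * (1 + v * exp (- t s))))" for s
  have sub: "(\<psi> has_integral 2 * pi * integral ?J k) {0..1}"
  proof -
    have "((\<lambda>s. (2 * R * \<rho> * exp (\<rho> * t s)) *\<^sub>R k (exp (\<rho> * t s))) has_integral
            integral {exp (\<rho> * t 0)..exp (\<rho> * t 1)} k) {0..1}"
    proof (rule has_integral_substitution)
      show "exp (\<rho> * t 0) \<le> exp (\<rho> * t 1)" using R \<rho> by (simp add: t_def)
      show "(\<lambda>s. exp (\<rho> * t s)) ` {0..1} \<subseteq> ?J"
        using R \<rho> by (auto simp: t_def intro!: mult_left_mono) (simp add: algebra_simps)
      show "continuous_on ?J k" by (rule cont)
      show "((\<lambda>s. exp (\<rho> * t s)) has_real_derivative 2 * R * \<rho> * exp (\<rho> * t x)) (at x within {0..1})" for x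
        unfolding t_def by (auto intro!: derivative_eq_intros)
    qed simp
    then have "((\<lambda>s. 2 * pi * ((2 * R * \<rho> * exp (\<rho> * t s)) *\<^sub>R k (exp (\<rho> * t s)))) has_integral
            2 * pi * integral ?J k) {0..1}"
      by (intro has_integral_mult_right) (simp add: t_def)
    also have "(\<lambda>s. 2 * pi * ((2 * R * \<rho> * exp (\<rho> * t s)) *\<^sub>R k (exp (\<rho> * t s)))) = \<psi>"
    proof
      fix s
      have "exp (\<rho> * t s) powr (- 1 / \<rho>) = exp (- t s)"
        using \<rho> by (simp add: powr_def)
      then show "2 * pi * ((2 * R * \<rho> * exp (\<rho> * t s)) *\<^sub>R k (exp (\<rho> * t s))) = \<psi> s"
        using \<rho> by (simp add: \<psi>_def k_def K_density_def)
    qed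
    finally show ?thesis .
  qed
  define p1 p2 p3 p4 where "p1 = Complex (-R) (-pi)" and "p2 = Complex R (-pi)"
    and "p3 = Complex R pi" and "p4 = Complex (-R) pi"
  have seg: "closed_segment p1 p2 \<subseteq> {w. w \<noteq> of_real (ln v) \<and> \<bar>Im w\<bar> \<le> pi}"
    "closed_segment p2 p3 \<subseteq> {w. Re w = R \<and> \<bar>Im w\<bar> \<le> pi}"
    "closed_segment p4 p3 \<subseteq> {w. w \<noteq> of_real (ln v) \<and> \<bar>Im w\<bar> \<le> pi}"
    "closed_segment p4 p1 \<subseteq> {w. Re w = - R \<and> \<bar>Im w\<bar> \<le> pi}"
    using R unfolding p1_def p2_def p3_def p4_def
    by (auto simp: closed_segment_same_Re closed_segment_same_Im closed_segment_eq_real_ivl)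
  have strip: "w \<in> closed_strip_neighbourhood \<rho>" if "\<bar>Im w\<bar> \<le> pi" for w
    using that by (rule mem_closed_strip_neighbourhood[OF \<rho>])
  have cont\<phi>: "continuous_on {w. w \<noteq> of_real (ln v) \<and> \<bar>Im w\<bar> \<le> pi} ?\<phi>"
    unfolding strip_kernel_def
    using strip_kernel_zeros[OF \<rho>(1) v] strip by (intro continuous_intros) auto
  have not_z: "w \<noteq> of_real (ln v)" if "Re w = R \<or> Re w = - R" for w
    using that R by auto
  have cs: "continuous_on (closed_segment p1 p2) ?\<phi>" "continuous_on (closed_segment p2 p3) ?\<phi>"
    "continuous_on (closed_segment p4 p3) ?\<phi>" "continuous_on (closed_segment p4 p1) ?\<phi>"
    using seg not_z by (auto intro!: continuous_on_subset[OF cont\<phi>])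
  have cs': "continuous_on (closed_segment p3 p4) ?\<phi>"
    using cs(3) by (simp add: closed_segment_commute)
  note ci = cs[THEN contour_integrable_continuous_linepath] cs'[THEN contour_integrable_continuous_linepath]
  \<comment> \<open>The residue theorem, side by side.\<close>
  have split: "2 * pi * \<i> * complex_of_real (1 / (1 + v powr \<rho>)) = contour_integral (linepath p1 p2) ?\<phi>
      + contour_integral (linepath p2 p3) ?\<phi> + contour_integral (linepath p3 p4) ?\<phi>
      + contour_integral (linepath p4 p1) ?\<phi>"
  proof -
    have "rectpath p1 p3 = linepath p1 p2 +++ linepath p2 p3 +++ linepath p3 p4 +++ linepath p4 p1"
      by (simp add: rectpath_def p1_def p2_def p3_def p4_def Let_def)
    then have "contour_integral (rectpath p1 p3) ?\<phi> = contour_integral (linepath p1 p2) ?\<phi>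
      + contour_integral (linepath p2 p3) ?\<phi> + contour_integral (linepath p3 p4) ?\<phi>
      + contour_integral (linepath p4 p1) ?\<phi>"
      using ci by (simp add: add.assoc)
    then show ?thesis
      using strip_kernel_contour_integral[OF \<rho> v R(1)] by (simp add: p1_def p3_def)
  qed
  have "contour_integral (linepath p1 p2) ?\<phi> + contour_integral (linepath p3 p4) ?\<phi>
      = contour_integral (linepath p1 p2) ?\<phi> - contour_integral (linepath p4 p3) ?\<phi>"
    using contour_integral_reverse_linepath[OF cs(3)] by simp
  also have "\<dots> = \<i> * of_real (2 * pi * integral ?J k)"
  proof (rule has_integral_unique)
    have hi: "((\<lambda>s. ?\<phi> (linepath a b s) * (b - a)) has_integral contour_integral (linepath a b) ?\<phi>) {0..1}"
      if "?\<phi> contour_integrable_on linepath a b" for a b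
      using has_contour_integral_integral[OF that] unfolding has_contour_integral_linepath .
    show "((\<lambda>s. ?\<phi> (linepath p1 p2 s) * (p2 - p1) - ?\<phi> (linepath p4 p3 s) * (p3 - p4)) has_integral
      contour_integral (linepath p1 p2) ?\<phi> - contour_integral (linepath p4 p3) ?\<phi>) {0..1}"
      by (intro has_integral_diff hi ci)
    have lp: "linepath p1 p2 s = Complex (t s) (-pi)" "linepath p4 p3 s = Complex (t s) pi" for s
      by (simp_all add: linepath_def p1_def p2_def p3_def p4_def t_def complex_eq_iff algebra_simps)
    have df: "p2 - p1 = of_real (2 * R)" "p3 - p4 = of_real (2 * R)"
      by (simp_all add: p1_def p2_def p3_def p4_def complex_eq_iff)
    have "(\<lambda>s. ?\<phi> (linepath p1 p2 s) * (p2 - p1) - ?\<phi> (linepath p4 p3 s) * (p3 - p4))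
      = (\<lambda>s. \<i> * of_real (\<psi> s))"
      unfolding lp df by (simp add: fun_eq_iff \<psi>_def strip_kernel_horizontal flip: left_diff_distrib)
    moreover have "((\<lambda>s. \<i> * of_real (\<psi> s)) has_integral \<i> * of_real (2 * pi * integral ?J k)) {0..1}"
      using sub by (intro has_integral_mult_right has_integral_of_real)
    ultimately show "((\<lambda>s. ?\<phi> (linepath p1 p2 s) * (p2 - p1) - ?\<phi> (linepath p4 p3 s) * (p3 - p4)) has_integral
      \<i> * of_real (2 * pi * integral ?J k)) {0..1}" by simp
  qed
  finally have horiz: "contour_integral (linepath p1 p2) ?\<phi> + contour_integral (linepath p3 p4) ?\<phi>
      = \<i> * of_real (2 * pi * integral ?J k)" .
  have lnv: "- R < ln v" "ln v < R" using R by auto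
  have vR: "v * exp (- R) < 1" "1 < v * exp R"
    using lnv v exp_less_mono[OF lnv(1)] exp_less_mono[OF lnv(2)]
    by (simp_all add: exp_minus field_simps)
  have eR: "1 < exp (\<rho> * R)" "exp (- \<rho> * R) < 1" using \<rho> R by simp_all
  have right: "cmod (contour_integral (linepath p2 p3) ?\<phi>) \<le> B1 * cmod (p3 - p2)"
  proof (rule contour_integral_bound_linepath[OF ci(2)])
    show "0 \<le> B1" using vR eR by (simp add: B1_def)
    fix w assume "w \<in> closed_segment p2 p3"
    then have w: "Re w = R" using seg by auto
    have "exp (\<rho> * R) - 1 \<le> cmod (1 + exp (of_real \<rho> * w))"
      using norm_diff_ineq[of "exp (of_real \<rho> * w)" 1] w by (simp add: add.commute)
    moreover have "1 - v * exp (- R) \<le> cmod (1 - of_real v * exp (- w))"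
      using norm_triangle_ineq2[of 1 "of_real v * exp (- w)"] w v by (simp add: norm_mult)
    ultimately show "cmod (?\<phi> w) \<le> B1"
      unfolding B1_def strip_kernel_def norm_divide norm_mult norm_one
      using vR eR by (intro divide_left_mono mult_mono mult_pos_pos) auto
  qed
  have left: "cmod (contour_integral (linepath p4 p1) ?\<phi>) \<le> B2 * cmod (p1 - p4)"
  proof (rule contour_integral_bound_linepath[OF ci(4)])
    show "0 \<le> B2" using vR eR by (simp add: B2_def)
    fix w assume "w \<in> closed_segment p4 p1"
    then have w: "Re w = - R" using seg by auto
    have "1 - exp (- \<rho> * R) \<le> cmod (1 + exp (of_real \<rho> * w))"
      using norm_diff_ineq[of 1 "exp (of_real \<rho> * w)"] w by simp
    moreover have "v * exp R - 1 \<le> cmod (1 - of_real v * exp (- w))"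
      using norm_triangle_ineq2[of "of_real v * exp (- w)" 1] w v by (simp add: norm_mult norm_minus_commute)
    ultimately show "cmod (?\<phi> w) \<le> B2"
      unfolding B2_def strip_kernel_def norm_divide norm_mult norm_one
      using vR eR by (intro divide_left_mono mult_mono mult_pos_pos) auto
  qed
  have len: "cmod (p3 - p2) = 2 * pi" "cmod (p1 - p4) = 2 * pi"
    by (simp_all add: p1_def p2_def p3_def p4_def cmod_def real_sqrt_mult)
  let ?E = "integral ?J k - 1 / (1 + v powr \<rho>)"
  have "\<i> * of_real (2 * pi * ?E)
     = - (contour_integral (linepath p2 p3) ?\<phi> + contour_integral (linepath p4 p1) ?\<phi>)"
    using horiz split by (simp add: algebra_simps)
  from arg_cong[OF this, of cmod]
  have "2 * pi * \<bar>?E\<bar> = cmod (contour_integral (linepath p2 p3) ?\<phi> + contour_integral (linepath p4 p1) ?\<phi>)"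
    unfolding norm_mult norm_of_real norm_minus_cancel by (simp add: abs_mult)
  also have "\<dots> \<le> B1 * (2 * pi) + B2 * (2 * pi)"
    using norm_triangle_ineq right left unfolding len by (meson add_mono order_trans)
  finally have "2 * pi * \<bar>?E\<bar> \<le> 2 * pi * (B1 + B2)" by (simp add: algebra_simps)
  then show "\<bar>?E\<bar> \<le> B1 + B2" by simp
qed

text \<open>
  With $Y = K_\<rho>^{-1/\<rho>}$ this says that the Stieltjes-type transform $E 1/(1 + vY)$ is
  $1/(1+v^\<rho>)$. It is what turns the Mittag-Leffler transform of index $\<delta>'$ into the one of
  index $\<delta> = \<rho>\<delta>'$.
\<close>

lemma K_density_stieltjes_transform:
  assumes \<rho>: "0 < \<rho>" "\<rho> < 1" and v: "0 < v"
  shows "(\<integral>\<^sup>+x. ennreal (K_density \<rho> x / (1 + v * x powr (- 1 / \<rho>))) \<partial>lborel)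
         = ennreal (1 / (1 + v powr \<rho>))"
proof -
  define k where "k x = K_density \<rho> x / (1 + v * x powr (- 1 / \<rho>))" for x
  define J where "J n = {exp (- \<rho> * real n)..exp (\<rho> * real n)}" for n
  have k_nonneg: "0 \<le> k x" for x
    using K_density_nonneg[OF \<rho>, of x] v by (simp add: k_def)
  have [measurable]: "k \<in> borel_measurable borel" unfolding k_def by measurable
  have kfun: "k = (\<lambda>x. K_density \<rho> x / (1 + v * x powr (- 1 / \<rho>)))"
    by (simp add: fun_eq_iff k_def)
  have err: "(\<lambda>R. 1 / ((exp (\<rho> * R) - 1) * (1 - v * exp (- R)))
           + 1 / ((1 - exp (- \<rho> * R)) * (v * exp R - 1))) \<longlonglongrightarrow> 0"
    using \<rho> v by real_asymp
  have "\<forall>\<^sub>F n in sequentially. \<bar>ln v\<bar> < real n"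
    using filterlim_real_sequentially by (simp add: filterlim_at_top_dense)
  then have ev: "\<forall>\<^sub>F n in sequentially. \<bar>ln v\<bar> < real n \<and> 0 < real n"
    by eventually_elim linarith
  have "(\<lambda>n. integral (J n) k - 1 / (1 + v powr \<rho>)) \<longlonglongrightarrow> 0"
  proof (rule Lim_null_comparison[OF _ err])
    show "\<forall>\<^sub>F n in sequentially. norm (integral (J n) k - 1 / (1 + v powr \<rho>))
         \<le> 1 / ((exp (\<rho> * n) - 1) * (1 - v * exp (- real n)))
           + 1 / ((1 - exp (- \<rho> * n)) * (v * exp (real n) - 1))"
      using ev
    proof eventually_elim
      case (elim n)
      then show ?case
        using K_density_truncated_integral(2)[OF \<rho> v, of "real n"]
        unfolding real_norm_def J_def kfun by blast
    qed
  qed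
  then have lim1: "(\<lambda>n. ennreal (integral (J n) k)) \<longlonglongrightarrow> ennreal (1 / (1 + v powr \<rho>))"
    by (intro tendsto_ennrealI) (simp add: LIM_zero_iff)
  have "\<forall>\<^sub>F n in sequentially. (\<integral>\<^sup>+x. ennreal (k x) * indicator (J n) x \<partial>lborel) = ennreal (integral (J n) k)"
    using ev
  proof eventually_elim
    case (elim n)
    then have "k integrable_on J n"
      using K_density_truncated_integral(1)[OF \<rho> v, of "real n"]
      unfolding J_def kfun by blast
    then have "(k has_integral integral (J n) k) (J n)" by blast
    then show ?case
      using k_nonneg by (rule nn_integral_has_integral_lebesgue'[rotated])
  qed
  with lim1 have lim1: "(\<lambda>n. \<integral>\<^sup>+x. ennreal (k x) * indicator (J n) x \<partial>lborel) \<longlonglongrightarrow> ennreal (1 / (1 + v powr \<rho>))"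
    by (simp add: tendsto_cong)
  have "(\<lambda>n. \<integral>\<^sup>+x. ennreal (k x) * indicator (J n) x \<partial>lborel) \<longlonglongrightarrow> (\<integral>\<^sup>+x. ennreal (k x) \<partial>lborel)"
  proof (rule nn_integral_LIMSEQ)
    have "J m \<subseteq> J n" if "m \<le> n" for m n
      using that \<rho> by (auto simp: J_def elim!: order_trans order_trans[rotated])
    then show "incseq (\<lambda>n x. ennreal (k x) * indicator (J n) x)"
      by (auto simp: incseq_def le_fun_def split: split_indicator)
    show "(\<lambda>n. ennreal (k x) * indicator (J n) x) \<longlonglongrightarrow> ennreal (k x)" for x
    proof (cases "0 < x")
      case True
      have "\<forall>\<^sub>F n in sequentially. \<bar>ln x\<bar> / \<rho> < real n"
        using filterlim_real_sequentially by (simp add: filterlim_at_top_dense)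
      then have "\<forall>\<^sub>F n in sequentially. x \<in> J n"
      proof eventually_elim
        case (elim n)
        then have "\<bar>ln x\<bar> \<le> \<rho> * real n" using \<rho> by (simp add: field_simps)
        then have "exp (- \<rho> * real n) \<le> exp (ln x)" "exp (ln x) \<le> exp (\<rho> * real n)"
          by (auto simp: abs_le_iff)
        then show ?case using True by (simp add: J_def)
      qed
      then show ?thesis
        by (intro tendsto_eventually) (auto elim!: eventually_mono)
    qed (simp add: k_def K_density_def)
  qed (simp add: J_def)
  from LIMSEQ_unique[OF this lim1] show ?thesis by (simp add: k_def)
qed

section \<open>Laplace transforms of laws on the half-line\<close>

text \<open>
  For $X \<ge> 0$ the variable $e^{-X}$ is bounded, so its characteristic function is the sum of its
  moment series, and its moments are the values of the Laplace transform of $X$ at the nonnegative integers.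
\<close>

lemma char_exp_minus:
  assumes "real_distribution \<mu>" and nonneg: "AE x in \<mu>. 0 \<le> x"
  shows "(\<lambda>n. complex_of_real ((\<integral>x. exp (- real n * x) \<partial>\<mu>)) * ((\<i> * of_real t) ^ n / fact n)) sums
           char (distr \<mu> borel (\<lambda>x. exp (- x))) t"
proof -
  interpret \<mu>: real_distribution \<mu> by fact
  have le1: "AE x in \<mu>. exp (- real n * x) \<le> 1" for n
    using nonneg by eventually_elim (simp add: mult_nonneg_nonneg)
  define f where "f n x = of_real (exp (- real n * x)) * ((\<i> * of_real t) ^ n / fact n)" for n and x :: real
  have bound: "AE x in \<mu>. norm (f n x) \<le> \<bar>t\<bar> ^ n / fact n" for n
    using le1[of n]
  proof eventually_elim
    case (elim x)
    then have "exp (- real n * x) * (\<bar>t\<bar> ^ n / fact n) \<le> 1 * (\<bar>t\<bar> ^ n / fact n)"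
      by (intro mult_right_mono) auto
    then show ?case by (simp add: f_def norm_mult norm_divide norm_power)
  qed
  have int: "integrable \<mu> (f n)" for n
    using bound[of n] by (rule \<mu>.integrable_const_bound) (simp add: f_def)
  have exp_int: "integrable \<mu> (\<lambda>x. complex_of_real (exp (- real n * x)))" for n
    using le1[of n] by (intro \<mu>.integrable_const_bound[where B=1]) auto
  have summ: "summable (\<lambda>n. \<bar>t\<bar> ^ n / fact n)"
    using summable_exp[of "\<bar>t\<bar>"] by (simp add: field_simps)
  have "AE x in \<mu>. \<forall>n. norm (f n x) \<le> \<bar>t\<bar> ^ n / fact n"
    using bound by (simp add: AE_all_countable)
  then have AE_summ: "AE x in \<mu>. summable (\<lambda>n. norm (f n x))"
    by eventually_elim (auto intro: summable_comparison_test'[OF summ])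
  have norm_summ: "summable (\<lambda>n. \<integral>x. norm (f n x) \<partial>\<mu>)"
  proof (rule summable_comparison_test'[OF summ])
    fix n
    have "(\<integral>x. norm (f n x) \<partial>\<mu>) \<le> (\<integral>x. \<bar>t\<bar> ^ n / fact n \<partial>\<mu>)"
      using bound[of n] int by (intro integral_mono_AE) auto
    then show "norm (\<integral>x. norm (f n x) \<partial>\<mu>) \<le> \<bar>t\<bar> ^ n / fact n"
      using \<mu>.prob_space by simp
  qed
  have "(\<lambda>n. \<integral>x. f n x \<partial>\<mu>) sums (\<integral>x. (\<Sum>n. f n x) \<partial>\<mu>)"
    by (rule sums_integral[OF int AE_summ norm_summ])
  moreover have "(\<Sum>n. f n x) = iexp (t * exp (- x))" for x
  proof -
    have "f n x = (\<i> * of_real t * of_real (exp (- x))) ^ n /\<^sub>R fact n" for n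
      by (simp add: f_def power_mult_distrib exp_of_nat_mult[symmetric] scaleR_conv_of_real field_simps flip: of_real_power)
    then have "(\<Sum>n. f n x) = exp (\<i> * of_real t * of_real (exp (- x)))"
      by (simp add: exp_def)
    then show ?thesis by (simp add: mult.assoc)
  qed
  moreover have "(\<integral>x. f n x \<partial>\<mu>) = of_real ((\<integral>x. exp (- real n * x) \<partial>\<mu>)) * ((\<i> * of_real t) ^ n / fact n)" for n
    unfolding f_def by (simp add: exp_int flip: of_real_power of_real_exp)
  ultimately show ?thesis by (simp add: char_def integral_distr)
qed

lemma nonneg_law_eqI_laplace:
  assumes "nonneg_law_with_laplace \<mu> \<phi>" and "nonneg_law_with_laplace \<nu> \<phi>"
  shows "\<mu> = \<nu>"
proof -
  interpret \<mu>: real_distribution \<mu> using assms by (simp add: nonneg_law_with_laplace_def)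
  interpret \<nu>: real_distribution \<nu> using assms by (simp add: nonneg_law_with_laplace_def)
  have dist: "real_distribution (distr \<mu> borel (\<lambda>x. exp (- x)))"
     "real_distribution (distr \<nu> borel (\<lambda>x. exp (- x)))"
    by simp_all
  have "char (distr \<mu> borel (\<lambda>x. exp (- x))) t = char (distr \<nu> borel (\<lambda>x. exp (- x))) t" for t
    using assms char_exp_minus[of \<mu> t] char_exp_minus[of \<nu> t]
    by (auto simp: nonneg_law_with_laplace_def intro: sums_unique2)
  then have eq: "distr \<mu> borel (\<lambda>x. exp (- x)) = distr \<nu> borel (\<lambda>x. exp (- x))"
    using dist by (intro Levy_uniqueness) auto
  have inv: "distr (distr \<rho> borel (\<lambda>x. exp (- x))) borel (\<lambda>y. - ln y) = \<rho>"
    if "sets \<rho> = sets borel" for \<rho> :: "real measure"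
  proof -
    note [measurable_cong] = that
    have "distr (distr \<rho> borel (\<lambda>x. exp (- x))) borel (\<lambda>y. - ln y)
        = distr \<rho> borel ((\<lambda>y. - ln y) \<circ> (\<lambda>x. exp (- x)))"
      by (rule distr_distr) measurable
    also have "\<dots> = \<rho>" by (simp add: comp_def distr_id2 that)
    finally show ?thesis .
  qed
  have "\<mu> = distr (distr \<mu> borel (\<lambda>x. exp (- x))) borel (\<lambda>y. - ln y)"
    by (rule inv[symmetric]) simp
  also have "\<dots> = distr (distr \<nu> borel (\<lambda>x. exp (- x))) borel (\<lambda>y. - ln y)"
    by (simp only: eq)
  also have "\<dots> = \<nu>" by (rule inv) simp
  finally show ?thesis .
qed

lemma nonneg_law_nn_laplace:
  assumes "nonneg_law_with_laplace \<mu> \<phi>" and s: "0 \<le> s"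
  shows "(\<integral>\<^sup>+x. ennreal (exp (- s * x)) \<partial>\<mu>) = ennreal (\<phi> s)"
proof -
  interpret real_distribution \<mu> using assms by (simp add: nonneg_law_with_laplace_def)
  have "AE x in \<mu>. norm (exp (- s * x)) \<le> 1"
    using assms by (auto simp: nonneg_law_with_laplace_def)
  then have "integrable \<mu> (\<lambda>x. exp (- s * x))"
    by (rule integrable_const_bound) simp
  then have "(\<integral>\<^sup>+x. ennreal (exp (- s * x)) \<partial>\<mu>) = ennreal (\<integral>x. exp (- s * x) \<partial>\<mu>)"
    by (rule nn_integral_eq_integral) simp
  then show ?thesis using assms by (simp add: nonneg_law_with_laplace_def)
qed

lemma nonneg_law_with_laplaceI:
  assumes "real_distribution \<mu>" and "AE x in \<mu>. 0 \<le> x"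
    and "\<And>s. 0 < s \<Longrightarrow> (\<integral>\<^sup>+x. ennreal (exp (- s * x)) \<partial>\<mu>) = ennreal (\<phi> s)"
    and "\<And>s. 0 \<le> s \<Longrightarrow> 0 \<le> \<phi> s" and "\<phi> 0 = 1"
  shows "nonneg_law_with_laplace \<mu> \<phi>"
proof -
  interpret real_distribution \<mu> by fact
  have "(\<integral>x. exp (- s * x) \<partial>\<mu>) = \<phi> s" if s: "0 \<le> s" for s
  proof (cases "s = 0")
    case True
    then show ?thesis using prob_space assms(5) by simp
  next
    case False
    then show ?thesis using s assms(3)[of s] assms(4)[of s]
      by (intro integral_eq_nn_integral[THEN trans]) auto
  qed
  then show ?thesis using assms by (simp add: nonneg_law_with_laplace_def)
qed

text \<open>
  An atom at $0$ would stay in the Laplace transform as $s \<rightarrow> \<infinity>$.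
\<close>

lemma nonneg_law_AE_pos:
  assumes \<mu>: "nonneg_law_with_laplace \<mu> \<phi>" and lim: "(\<phi> \<longlongrightarrow> 0) at_top"
  shows "AE x in \<mu>. 0 < x"
proof -
  interpret real_distribution \<mu> using \<mu> by (simp add: nonneg_law_with_laplace_def)
  have nonneg: "AE x in \<mu>. 0 \<le> x" using \<mu> by (simp add: nonneg_law_with_laplace_def)
  have le: "measure \<mu> {0} \<le> \<phi> s" if "0 \<le> s" for s
  proof -
    have "emeasure \<mu> {0} = (\<integral>\<^sup>+x. indicator {0} x \<partial>\<mu>)" by simp
    also have "\<dots> \<le> (\<integral>\<^sup>+x. ennreal (exp (- s * x)) \<partial>\<mu>)"
      by (intro nn_integral_mono) (auto split: split_indicator)
    also have "\<dots> = ennreal (\<phi> s)" by (rule nonneg_law_nn_laplace[OF \<mu> that])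
    finally have "ennreal (measure \<mu> {0}) \<le> ennreal (\<phi> s)" by (simp add: emeasure_eq_measure)
    moreover have "0 \<le> \<phi> s"
      using \<mu> that unfolding nonneg_law_with_laplace_def by (metis integral_nonneg_AE AE_I2 exp_ge_zero)
    ultimately show ?thesis by simp
  qed
  have "measure \<mu> {0} \<le> 0"
    using lim by (rule tendsto_lowerbound) (auto intro: eventually_mono[OF eventually_ge_at_top[of 0]] le)
  then have "emeasure \<mu> {0} = 0"
    by (simp add: emeasure_eq_measure measure_le_0_iff)
  then have "AE x in \<mu>. x \<noteq> 0"
    by (intro AE_I[of _ _ "{0}"]) auto
  with nonneg show ?thesis by eventually_elim auto
qed

section \<open>The Mittag-Leffler law as a mixture\<close>

text \<open>
  Conditionally on $K$, the coefficient $c(K)$ is an admissible argument of the Laplace transform of $S$.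
\<close>

lemma (in prob_space) stable_laplace_randomized:
  fixes S K :: "'a \<Rightarrow> real"
  assumes S: "one_sided_stable_law \<beta> (distr M borel S)"
    and indep: "indep_var borel S borel K"
    and c: "c \<in> borel_measurable borel" and c_nonneg: "\<And>x. 0 \<le> c x"
  shows "(\<integral>\<^sup>+\<omega>. ennreal (exp (- c (K \<omega>) * S \<omega>)) \<partial>M)
         = (\<integral>\<^sup>+\<omega>. ennreal (exp (- (c (K \<omega>) powr \<beta>))) \<partial>M)"
proof -
  note [measurable] = c
  have [measurable]: "S \<in> borel_measurable M" "K \<in> borel_measurable M"
    using indep_var_rv1[OF indep] indep_var_rv2[OF indep] by auto
  have joint: "distr M borel S \<Otimes>\<^sub>M distr M borel K = distr M (borel \<Otimes>\<^sub>M borel) (\<lambda>\<omega>. (S \<omega>, K \<omega>))"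
    using indep by (simp add: indep_var_distribution_eq)
  interpret S: prob_space "distr M borel S" by (rule prob_space_distr) measurable
  interpret K: prob_space "distr M borel K" by (rule prob_space_distr) measurable
  interpret SK: pair_prob_space "distr M borel S" "distr M borel K" ..
  let ?f = "\<lambda>(s, k). ennreal (exp (- c k * s))"
  have "(\<integral>\<^sup>+\<omega>. ennreal (exp (- c (K \<omega>) * S \<omega>)) \<partial>M)
      = (\<integral>\<^sup>+p. ?f p \<partial>(distr M borel S \<Otimes>\<^sub>M distr M borel K))"
    unfolding joint by (subst nn_integral_distr) auto
  also have "\<dots> = (\<integral>\<^sup>+k. \<integral>\<^sup>+s. ?f (s, k) \<partial>distr M borel S \<partial>distr M borel K)"
    by (rule SK.nn_integral_snd[symmetric]) simp
  also have "\<dots> = (\<integral>\<^sup>+k. ennreal (exp (- (c k powr \<beta>))) \<partial>distr M borel K)"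
    using nonneg_law_nn_laplace[OF S[unfolded one_sided_stable_law_def] c_nonneg] by simp
  also have "\<dots> = (\<integral>\<^sup>+\<omega>. ennreal (exp (- (c (K \<omega>) powr \<beta>))) \<partial>M)"
    by (subst nn_integral_distr) auto
  finally show ?thesis .
qed

abbreviation unit_exponential :: "real measure" where
  "unit_exponential \<equiv> density lborel (\<lambda>x. ennreal (exponential_density 1 x))"

text \<open>
  The truncation at $0$ only affects a null set; it keeps fractional powers of the exponential variable well-behaved everywhere.
\<close>

lemma unit_exponential_laplace:
  assumes c: "0 \<le> c"
  shows "(\<integral>\<^sup>+x. ennreal (exp (- (c * max x 0))) \<partial>unit_exponential) = ennreal (1 / (1 + c))"
proof -
  have "(\<integral>\<^sup>+x. ennreal (exp (- (c * max x 0))) \<partial>unit_exponential)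
      = (\<integral>\<^sup>+x. ennreal (exponential_density 1 x) * ennreal (exp (- (c * max x 0))) \<partial>lborel)"
    by (subst nn_integral_density) auto
  also have "\<dots> = (\<integral>\<^sup>+x. ennreal (1 / (1 + c)) * ennreal (exponential_density (1 + c) x) \<partial>lborel)"
  proof (rule nn_integral_cong)
    fix x :: real
    have "exponential_density 1 x * exp (- (c * max x 0)) = 1 / (1 + c) * exponential_density (1 + c) x"
    proof (cases "x < 0")
      case False
      have "exp (- x) * exp (- (c * x)) = exp (- x * (1 + c))"
        by (simp add: algebra_simps flip: exp_add)
      then show ?thesis using False c by (simp add: exponential_density_def)
    qed (simp add: exponential_density_def)
    then show "ennreal (exponential_density 1 x) * ennreal (exp (- (c * max x 0)))
        = ennreal (1 / (1 + c)) * ennreal (exponential_density (1 + c) x)"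
      using c by (simp add: exponential_density_nonneg flip: ennreal_mult)
  qed
  also have "\<dots> = ennreal (1 / (1 + c)) * (\<integral>\<^sup>+x. ennreal (exponential_density (1 + c) x) \<partial>lborel)"
    by (rule nn_integral_cmult) simp
  also have "(\<integral>\<^sup>+x. ennreal (exponential_density (1 + c) x) \<partial>lborel) = 1"
    using prob_space.emeasure_space_1[OF prob_space_exponential_density[of "1 + c"]] c
    by (simp add: emeasure_density)
  finally show ?thesis by simp
qed

lemma unit_exponential_tail:
  assumes a: "0 \<le> a"
  shows "emeasure unit_exponential {a<..} = ennreal (exp (- a))"
proof -
  interpret prob_space unit_exponential by (rule prob_space_exponential_density) simp
  have "distributed unit_exponential lborel (\<lambda>x. x) (exponential_density 1)"
    by (auto simp: distributed_def intro!: distr_id2)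
  from exponential_distributedD_gt[OF this a]
  have "measure unit_exponential {x \<in> space unit_exponential. a < x} = exp (- a)" by simp
  moreover have "{x \<in> space unit_exponential. a < x} = {a<..}" by auto
  ultimately show ?thesis by (simp add: emeasure_eq_measure)
qed

text \<open>
  Let $T$ be a standard exponential variable independent of $(S, K)$ and
  $Y = S T^{1/\<delta>'} K^{-1/\<delta>}$. Averaging over $S$, then over $T$, then over $K$ turns
  $e^{-sY}$ into $exp(-s^{\<delta>'} T K^{-\<delta>'/\<delta>})$, then into
  $1/(1 + s^{\<delta>'} K^{-\<delta>'/\<delta>})$, and finally into $1/(1 + s^\<delta>)$, so $Y$ has the
  Mittag-Leffler law. Averaging over $T$ first instead gives the tail of $Y$, since $Y > x$ means
  $T > x^{\<delta>'} S^{-\<delta>'} K^{\<delta>'/\<delta>}$.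
\<close>

lemma mittag_leffler_cdf:
  fixes S K :: "'b \<Rightarrow> real"
  assumes delta: "0 < \<delta>" "\<delta> < \<delta>'" and mu: "mittag_leffler_law \<delta> \<mu>"
    and Q: "prob_space Q"
    and S: "one_sided_stable_law \<delta>' (distr Q borel S)"
    and K: "distributed Q lborel K (\<lambda>x. ennreal (K_density (\<delta> / \<delta>') x))"
    and indep: "prob_space.indep_var Q borel S borel K"
    and x: "0 < x"
  shows "cdf \<mu> x = 1 - (\<integral>\<omega>. exp (- (x powr \<delta>' * (S \<omega> powr (- \<delta>') * K \<omega> powr (\<delta>' / \<delta>)))) \<partial>Q)"
proof -
  interpret Q: prob_space Q by fact
  interpret E: prob_space unit_exponential by (rule prob_space_exponential_density) simp
  interpret QE: pair_prob_space Q unit_exponential ..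
  interpret \<mu>: real_distribution \<mu>
    using mu by (simp add: mittag_leffler_law_def nonneg_law_with_laplace_def)
  define \<rho> where "\<rho> = \<delta> / \<delta>'"
  have \<rho>: "0 < \<rho>" "\<rho> < 1" using delta by (auto simp: \<rho>_def)
  have d': "0 < \<delta>'" using delta by simp
  have [measurable]: "S \<in> borel_measurable Q" "K \<in> borel_measurable Q"
    using Q.indep_var_rv1[OF indep] Q.indep_var_rv2[OF indep] by auto
  have S_pos: "AE \<omega> in Q. 0 < S \<omega>"
  proof -
    have "((\<lambda>s. exp (- (s powr \<delta>'))) \<longlongrightarrow> 0) at_top" using d' by real_asymp
    then have "AE s in distr Q borel S. 0 < s"
      using S unfolding one_sided_stable_law_def by (intro nonneg_law_AE_pos)
    then show ?thesis by (simp add: AE_distr_iff)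
  qed
  have K_pos: "AE \<omega> in Q. 0 < K \<omega>"
  proof -
    have "AE x in density lborel (\<lambda>x. ennreal (K_density \<rho> x)). 0 < x"
      by (subst AE_density) (auto simp: K_density_def)
    then have "AE x in distr Q lborel K. 0 < x"
      unfolding distributed_distr_eq_density[OF K] \<rho>_def .
    then show ?thesis by (simp add: AE_distr_iff)
  qed
  \<comment> \<open>The cut-offs at 0 change Y on a null set only and make it nonnegative everywhere.\<close>
  define Y where "Y = (\<lambda>(\<omega>, e). max (S \<omega>) 0 * (max e 0 powr (1 / \<delta>') * K \<omega> powr (- 1 / \<delta>)))"
  have Y_meas [measurable]: "Y \<in> borel_measurable (Q \<Otimes>\<^sub>M unit_exponential)"
    unfolding Y_def by measurable
  define \<nu> where "\<nu> = distr (Q \<Otimes>\<^sub>M unit_exponential) borel Y"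
  have "nonneg_law_with_laplace \<nu> (\<lambda>s. 1 / (1 + s powr \<delta>))"
  proof (rule nonneg_law_with_laplaceI)
    show "real_distribution \<nu>" unfolding \<nu>_def by (rule QE.real_distribution_distr) simp
    show "AE x in \<nu>. 0 \<le> x" unfolding \<nu>_def by (subst AE_distr_iff) (auto simp: Y_def)
    fix s :: real assume s: "0 < s"
    define c where "c e k = s * (max e 0 powr (1 / \<delta>') * k powr (- 1 / \<delta>))" for e k :: real
    have "(\<integral>\<^sup>+x. ennreal (exp (- s * x)) \<partial>\<nu>)
        = (\<integral>\<^sup>+p. ennreal (exp (- s * Y p)) \<partial>(Q \<Otimes>\<^sub>M unit_exponential))"
      unfolding \<nu>_def by (subst nn_integral_distr) auto
    also have "\<dots> = (\<integral>\<^sup>+e. \<integral>\<^sup>+\<omega>. ennreal (exp (- s * Y (\<omega>, e))) \<partial>Q \<partial>unit_exponential)"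
      by (rule QE.nn_integral_snd[symmetric]) simp
    also have "\<dots> = (\<integral>\<^sup>+e. \<integral>\<^sup>+\<omega>. ennreal (exp (- c e (K \<omega>) * S \<omega>)) \<partial>Q \<partial>unit_exponential)"
    proof (rule nn_integral_cong, rule nn_integral_cong_AE)
      fix e
      show "AE \<omega> in Q. ennreal (exp (- s * Y (\<omega>, e))) = ennreal (exp (- c e (K \<omega>) * S \<omega>))"
        using S_pos by eventually_elim (simp add: Y_def c_def mult_ac)
    qed
    also have "\<dots> = (\<integral>\<^sup>+e. \<integral>\<^sup>+\<omega>. ennreal (exp (- (c e (K \<omega>) powr \<delta>'))) \<partial>Q \<partial>unit_exponential)"
      using s by (intro nn_integral_cong Q.stable_laplace_randomized[OF S indep])
        (auto simp: c_def)
    also have "\<dots> = (\<integral>\<^sup>+\<omega>. \<integral>\<^sup>+e. ennreal (exp (- (c e (K \<omega>) powr \<delta>'))) \<partial>unit_exponential \<partial>Q)"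
      unfolding c_def by (rule QE.Fubini') measurable
    also have "\<dots> = (\<integral>\<^sup>+\<omega>. ennreal (1 / (1 + s powr \<delta>' * K \<omega> powr (- 1 / \<rho>))) \<partial>Q)"
    proof (rule nn_integral_cong_AE)
      show "AE \<omega> in Q. (\<integral>\<^sup>+e. ennreal (exp (- (c e (K \<omega>) powr \<delta>'))) \<partial>unit_exponential)
          = ennreal (1 / (1 + s powr \<delta>' * K \<omega> powr (- 1 / \<rho>)))"
        using K_pos
      proof eventually_elim
        case (elim \<omega>)
        have "c e (K \<omega>) powr \<delta>' = s powr \<delta>' * K \<omega> powr (- 1 / \<rho>) * max e 0" for e
          using s d' delta elim
          by (cases "0 < e") (simp_all add: c_def powr_mult powr_powr \<rho>_def)
        then show ?case
          using unit_exponential_laplace[of "s powr \<delta>' * K \<omega> powr (- 1 / \<rho>)"] by simp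
      qed
    qed
    also have "\<dots> = (\<integral>\<^sup>+x. ennreal (K_density \<rho> x) * ennreal (1 / (1 + s powr \<delta>' * x powr (- 1 / \<rho>))) \<partial>lborel)"
      using distributed_nn_integral[OF K, of "\<lambda>x. ennreal (1 / (1 + s powr \<delta>' * x powr (- 1 / \<rho>)))"]
      by (simp add: \<rho>_def)
    also have "\<dots> = (\<integral>\<^sup>+x. ennreal (K_density \<rho> x / (1 + s powr \<delta>' * x powr (- 1 / \<rho>))) \<partial>lborel)"
      by (intro nn_integral_cong) (simp add: K_density_nonneg[OF \<rho>] flip: ennreal_mult)
    also have "\<dots> = ennreal (1 / (1 + (s powr \<delta>') powr \<rho>))"
      using s by (intro K_density_stieltjes_transform \<rho>) simp
    also have "(s powr \<delta>') powr \<rho> = s powr \<delta>"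
      using d' by (simp add: powr_powr \<rho>_def)
    finally show "(\<integral>\<^sup>+x. ennreal (exp (- s * x)) \<partial>\<nu>) = ennreal (1 / (1 + s powr \<delta>))" .
  qed auto
  then have \<nu>: "\<mu> = \<nu>"
    using mu unfolding mittag_leffler_law_def by (intro nonneg_law_eqI_laplace)
  define g where "g \<omega> = x powr \<delta>' * (S \<omega> powr (- \<delta>') * K \<omega> powr (\<delta>' / \<delta>))" for \<omega>
  have [measurable]: "g \<in> borel_measurable Q" unfolding g_def by measurable
  have g_nonneg: "0 \<le> g \<omega>" for \<omega> by (simp add: g_def)
  have "emeasure \<mu> {x<..} = emeasure (Q \<Otimes>\<^sub>M unit_exponential) (Y -` {x<..} \<inter> space (Q \<Otimes>\<^sub>M unit_exponential))"
    unfolding \<nu> \<nu>_def by (subst emeasure_distr) auto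
  also have "\<dots> = (\<integral>\<^sup>+\<omega>. emeasure unit_exponential (Pair \<omega> -` (Y -` {x<..} \<inter> space (Q \<Otimes>\<^sub>M unit_exponential))) \<partial>Q)"
    by (rule E.emeasure_pair_measure_alt) measurable
  also have "\<dots> = (\<integral>\<^sup>+\<omega>. ennreal (exp (- g \<omega>)) \<partial>Q)"
  proof (rule nn_integral_cong_AE)
    show "AE \<omega> in Q. emeasure unit_exponential (Pair \<omega> -` (Y -` {x<..} \<inter> space (Q \<Otimes>\<^sub>M unit_exponential)))
        = ennreal (exp (- g \<omega>))"
      using S_pos K_pos AE_space
    proof eventually_elim
      case (elim \<omega>)
      have "x < Y (\<omega>, e) \<longleftrightarrow> g \<omega> < e" for e
      proof (cases "0 < e")
        case True
        have "(S \<omega> powr (- \<delta>')) powr (1 / \<delta>') = inverse (S \<omega>)"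
          unfolding powr_powr using elim d' by (simp add: powr_minus)
        then have gp: "g \<omega> powr (1 / \<delta>') = x * (inverse (S \<omega>) * K \<omega> powr (1 / \<delta>))"
          using elim x d' delta by (simp add: g_def powr_mult powr_powr)
        have "x < Y (\<omega>, e) \<longleftrightarrow> g \<omega> powr (1 / \<delta>') < e powr (1 / \<delta>')"
          using elim True unfolding gp by (simp add: Y_def powr_minus field_simps)
        also have "\<dots> \<longleftrightarrow> g \<omega> < e"
          using True d' g_nonneg[of \<omega>] powr_less_mono2[of "1 / \<delta>'" "g \<omega>" e]
            powr_mono2[of "1 / \<delta>'" e "g \<omega>"]
          by (cases "g \<omega> < e") auto
        finally show ?thesis .
      next
        case False
        then show ?thesis using x g_nonneg[of \<omega>] by (simp add: Y_def)
      qed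
      then have "Pair \<omega> -` (Y -` {x<..} \<inter> space (Q \<Otimes>\<^sub>M unit_exponential)) = {g \<omega><..}"
        using elim by (auto simp: space_pair_measure)
      then show ?case using unit_exponential_tail[OF g_nonneg] by simp
    qed
  qed
  also have "\<dots> = ennreal (\<integral>\<omega>. exp (- g \<omega>) \<partial>Q)"
    using g_nonneg by (intro nn_integral_eq_integral Q.integrable_const_bound[where B=1]) auto
  finally have "measure \<mu> {x<..} = (\<integral>\<omega>. exp (- g \<omega>) \<partial>Q)"
    by (simp add: \<mu>.emeasure_eq_measure)
  moreover have "measure \<mu> {x<..} = 1 - cdf \<mu> x"
  proof -
    have "{x<..} = space \<mu> - {..x}" by auto
    then show ?thesis using \<mu>.prob_compl[of "{..x}"] by (simp add: cdf_def)
  qed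
  ultimately show ?thesis by (simp add: g_def)
qed

section \<open>Minima of samples of Poisson size at an independent time\<close>

text \<open>
  The space is split according to the value of the index. The hypothesis asks for independence only through one identity for each value of the index, so that it
  serves for a sample size, for the value of a counting variable, and for a discretised time alike.
\<close>

lemma nn_integral_random_index:
  fixes J :: "'a \<Rightarrow> nat" and f :: "nat \<Rightarrow> 'a \<Rightarrow> ennreal"
  assumes J: "J \<in> measurable M (count_space UNIV)"
    and f: "\<And>j. f j \<in> borel_measurable M"
    and indep: "\<And>j. (\<integral>\<^sup>+\<omega>. f j \<omega> * indicator {\<omega>\<in>space M. J \<omega> = j} \<omega> \<partial>M)
                  = g j * emeasure M {\<omega>\<in>space M. J \<omega> = j}"
  shows "(\<integral>\<^sup>+\<omega>. f (J \<omega>) \<omega> \<partial>M) = (\<integral>\<^sup>+\<omega>. g (J \<omega>) \<partial>M)"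
proof -
  note [measurable] = J f
  let ?A = "\<lambda>j. {\<omega>\<in>space M. J \<omega> = j}"
  have disj: "disjoint_family ?A" by (auto simp: disjoint_family_on_def)
  have expand: "(\<Sum>j. h j * indicator (?A j) \<omega>) = h (J \<omega>)"
    if "\<omega> \<in> space M" for \<omega> and h :: "nat \<Rightarrow> ennreal"
    using that by (intro suminf_cmult_indicator[OF disj]) auto
  have "(\<integral>\<^sup>+\<omega>. f (J \<omega>) \<omega> \<partial>M) = (\<integral>\<^sup>+\<omega>. (\<Sum>j. f j \<omega> * indicator (?A j) \<omega>) \<partial>M)"
    by (rule nn_integral_cong) (simp add: expand)
  also have "\<dots> = (\<Sum>j. \<integral>\<^sup>+\<omega>. f j \<omega> * indicator (?A j) \<omega> \<partial>M)"
    by (rule nn_integral_suminf) measurable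
  also have "\<dots> = (\<Sum>j. \<integral>\<^sup>+\<omega>. g j * indicator (?A j) \<omega> \<partial>M)"
    by (simp add: indep nn_integral_cmult_indicator)
  also have "\<dots> = (\<integral>\<^sup>+\<omega>. (\<Sum>j. g j * indicator (?A j) \<omega>) \<partial>M)"
    by (rule nn_integral_suminf[symmetric]) measurable
  also have "\<dots> = (\<integral>\<^sup>+\<omega>. g (J \<omega>) \<partial>M)"
    by (rule nn_integral_cong) (simp add: expand)
  finally show ?thesis .
qed

lemma independent_rvs_prob:
  assumes "prob_space M" and "independent_rvs M Ma A Mb B" and "S \<in> sets Ma" "T \<in> sets Mb"
  shows "emeasure M ((B -` T \<inter> space M) \<inter> (A -` S \<inter> space M))
         = emeasure M (B -` T \<inter> space M) * emeasure M (A -` S \<inter> space M)"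
proof -
  interpret prob_space M by fact
  have "prob ((A -` S \<inter> space M) \<inter> (B -` T \<inter> space M)) = prob (A -` S \<inter> space M) * prob (B -` T \<inter> space M)"
    using assms unfolding independent_rvs_def by (intro indep_setD) auto
  then show ?thesis
    by (simp add: emeasure_eq_measure ennreal_mult'[symmetric] Int_commute mult.commute)
qed

lemma poisson_process_generating_function:
  assumes "prob_space M" and P: "poisson_process M 1 P" and t: "0 \<le> t" and q: "0 \<le> q"
  shows "(\<integral>\<^sup>+\<omega>. ennreal (q ^ P t \<omega>) \<partial>M) = ennreal (exp (- (t * (1 - q))))"
proof -
  interpret prob_space M by fact
  have P0: "P 0 \<omega> = 0" if "\<omega> \<in> space M" for \<omega>
    using P that by (simp add: poisson_process_def)
  have [measurable]: "P t \<in> measurable M (count_space UNIV)"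
    using P t by (simp add: poisson_process_def)
  show ?thesis
  proof (cases "t = 0")
    case True
    have "(\<integral>\<^sup>+\<omega>. ennreal (q ^ P t \<omega>) \<partial>M) = (\<integral>\<^sup>+\<omega>. 1 \<partial>M)"
      by (rule nn_integral_cong) (simp add: True P0)
    then show ?thesis by (simp add: True emeasure_space_1)
  next
    case False
    with t have tpos: "0 < t" by simp
    have "distr M (count_space UNIV) (P t) = distr M (count_space UNIV) (\<lambda>\<omega>. P t \<omega> - P 0 \<omega>)"
      by (rule distr_cong) (simp_all add: P0)
    also have "\<dots> = measure_pmf (poisson_pmf t)"
      using P tpos unfolding poisson_process_def
      by (metis diff_zero mult_1 order_refl)
    finally have distr: "distr M (count_space UNIV) (P t) = measure_pmf (poisson_pmf t)" .
    have sums: "(\<lambda>n. t ^ n / fact n * exp (- t) * q ^ n) sums exp (- (t * (1 - q)))"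
    proof -
      have "(\<lambda>n. (t * q) ^ n /\<^sub>R fact n * exp (- t)) sums (exp (t * q) * exp (- t))"
        by (intro sums_mult2 exp_converges)
      then show ?thesis
        by (simp add: power_mult_distrib field_simps flip: exp_add)
    qed
    have "(\<integral>\<^sup>+\<omega>. ennreal (q ^ P t \<omega>) \<partial>M) = (\<integral>\<^sup>+n. ennreal (q ^ n) \<partial>measure_pmf (poisson_pmf t))"
      unfolding distr[symmetric] by (subst nn_integral_distr) auto
    also have "\<dots> = (\<Sum>n. ennreal (t ^ n / fact n * exp (- t) * q ^ n))"
      using tpos q by (simp add: nn_integral_measure_pmf nn_integral_count_space_nat flip: ennreal_mult)
    also have "\<dots> = ennreal (exp (- (t * (1 - q))))"
      using t q sums by (intro suminf_ennreal_eq) auto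
    finally show ?thesis .
  qed
qed

lemma poisson_process_generating_function_on_event:
  assumes M: "prob_space M" and P: "poisson_process M 1 P"
    and indep: "independent_rvs M borel U (PiM {0..} (\<lambda>_. count_space UNIV)) (process_path P)"
    and t: "0 \<le> t" and q: "0 \<le> q" and B: "B \<in> sets borel"
  shows "(\<integral>\<^sup>+\<omega>. ennreal (q ^ P t \<omega>) * indicator (U -` B \<inter> space M) \<omega> \<partial>M)
       = ennreal (exp (- (t * (1 - q)))) * emeasure M (U -` B \<inter> space M)"
proof -
  interpret prob_space M by fact
  have [measurable]: "P t \<in> measurable M (count_space UNIV)"
    using P t by (simp add: poisson_process_def)
  have [measurable]: "U \<in> borel_measurable M" using indep by (simp add: independent_rvs_def)
  note [measurable] = B
  let ?A = "U -` B \<inter> space M"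
  let ?\<Pi> = "PiM {0..} (\<lambda>_. count_space UNIV) :: (real \<Rightarrow> nat) measure"
  have "(\<integral>\<^sup>+\<omega>. ennreal (q ^ P t \<omega>) * indicator ?A \<omega> \<partial>M)
      = (\<integral>\<^sup>+\<omega>. ennreal (q ^ P t \<omega>) * emeasure M ?A \<partial>M)"
  proof (rule nn_integral_random_index[where f = "\<lambda>m \<omega>. ennreal (q ^ m) * indicator ?A \<omega>"])
    fix m
    have "(\<lambda>p. p t) \<in> measurable ?\<Pi> (count_space UNIV)"
      using t by (intro measurable_component_singleton) auto
    then have T: "(\<lambda>p. p t) -` {m} \<inter> space ?\<Pi> \<in> sets ?\<Pi>"
      by (rule measurable_sets) simp
    have eqT: "process_path P -` ((\<lambda>p. p t) -` {m} \<inter> space ?\<Pi>) \<inter> space M = {\<omega>\<in>space M. P t \<omega> = m}"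
      using t by (auto simp: process_path_def space_PiM)
    have ind: "emeasure M ({\<omega>\<in>space M. P t \<omega> = m} \<inter> ?A) = emeasure M {\<omega>\<in>space M. P t \<omega> = m} * emeasure M ?A"
      using independent_rvs_prob[OF M indep B T] unfolding eqT .
    have "(\<integral>\<^sup>+\<omega>. ennreal (q ^ m) * indicator ?A \<omega> * indicator {\<omega>\<in>space M. P t \<omega> = m} \<omega> \<partial>M)
        = (\<integral>\<^sup>+\<omega>. ennreal (q ^ m) * indicator ({\<omega>\<in>space M. P t \<omega> = m} \<inter> ?A) \<omega> \<partial>M)"
      by (rule nn_integral_cong) (auto split: split_indicator)
    also have "\<dots> = ennreal (q ^ m) * emeasure M ({\<omega>\<in>space M. P t \<omega> = m} \<inter> ?A)"
      by (rule nn_integral_cmult_indicator) measurable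
    finally show "(\<integral>\<^sup>+\<omega>. ennreal (q ^ m) * indicator ?A \<omega> * indicator {\<omega>\<in>space M. P t \<omega> = m} \<omega> \<partial>M)
        = ennreal (q ^ m) * emeasure M ?A * emeasure M {\<omega>\<in>space M. P t \<omega> = m}"
      unfolding ind by (simp add: mult_ac)
  qed measurable
  also have "\<dots> = (\<integral>\<^sup>+\<omega>. ennreal (q ^ P t \<omega>) \<partial>M) * emeasure M ?A"
    by (rule nn_integral_multc) measurable
  finally show ?thesis
    using poisson_process_generating_function[OF M P t q] by simp
qed

text \<open>
  If $U$ takes countably many values, this is the generating function of the Poisson law, conditioned on
  $U$. A general $U$ is approximated from above by dyadic times, because the paths are continuous from
  the right; as they take integer values, they are even constant from some dyadic level on.
\<close>

lemma poisson_process_at_independent_time: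
  assumes M: "prob_space M" and P: "poisson_process M 1 P"
    and U_nonneg: "\<And>\<omega>. \<omega> \<in> space M \<Longrightarrow> 0 \<le> U \<omega>"
    and indep: "independent_rvs M borel U (PiM {0..} (\<lambda>_. count_space UNIV)) (process_path P)"
    and q: "0 \<le> q" "q \<le> 1"
  shows "(\<integral>\<^sup>+\<omega>. ennreal (q ^ P (U \<omega>) \<omega>) \<partial>M) = (\<integral>\<^sup>+\<omega>. ennreal (exp (- (U \<omega> * (1 - q)))) \<partial>M)"
proof -
  interpret prob_space M by fact
  have P_meas: "P t \<in> measurable M (count_space UNIV)" if "0 \<le> t" for t
    using P that by (simp add: poisson_process_def)
  have U_meas [measurable]: "U \<in> borel_measurable M" using indep by (simp add: independent_rvs_def)
  define J where "J n \<omega> = nat \<lceil>2 ^ n * U \<omega>\<rceil>" for n \<omega>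
  define T where "T n \<omega> = real (J n \<omega>) / 2 ^ n" for n \<omega>
  have J_meas [measurable]: "J n \<in> measurable M (count_space UNIV)" for n
    unfolding J_def by measurable
  have T_meas [measurable]: "T n \<in> borel_measurable M" for n
    unfolding T_def by measurable
  have T_bounds: "U \<omega> \<le> T n \<omega>" "T n \<omega> \<le> U \<omega> + (1/2) ^ n" if "\<omega> \<in> space M" for n \<omega>
  proof -
    have "real (J n \<omega>) = of_int \<lceil>2 ^ n * U \<omega>\<rceil>"
      using U_nonneg[OF that] by (simp add: J_def)
    then have "2 ^ n * U \<omega> \<le> real (J n \<omega>)" "real (J n \<omega>) \<le> 2 ^ n * U \<omega> + 1"
      using le_of_int_ceiling[of "2 ^ n * U \<omega>"] of_int_ceiling_le_add_one[of "2 ^ n * U \<omega>"] by auto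
    then show "U \<omega> \<le> T n \<omega>" "T n \<omega> \<le> U \<omega> + (1/2) ^ n"
      by (simp_all add: T_def field_simps)
  qed
  have T_lim: "(\<lambda>n. T n \<omega>) \<longlonglongrightarrow> U \<omega>" if "\<omega> \<in> space M" for \<omega>
  proof (rule tendsto_sandwich[where f = "\<lambda>_. U \<omega>"])
    show "(\<lambda>n. U \<omega> + (1/2) ^ n) \<longlonglongrightarrow> U \<omega>"
      by (auto intro!: tendsto_eq_intros LIMSEQ_realpow_zero)
  qed (use T_bounds[OF that] in auto)
  have P_lim: "\<forall>\<^sub>F n in sequentially. P (T n \<omega>) \<omega> = P (U \<omega>) \<omega>" if \<omega>: "\<omega> \<in> space M" for \<omega>
  proof -
    have "continuous (at_right (U \<omega>)) (\<lambda>s. P s \<omega>)"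
      using P U_nonneg[OF \<omega>] \<omega> by (simp add: poisson_process_def)
    then have "((\<lambda>s. P s \<omega>) \<longlongrightarrow> P (U \<omega>) \<omega>) (at_right (U \<omega>))"
      by (simp add: continuous_within)
    then have "\<forall>\<^sub>F s in at_right (U \<omega>). P s \<omega> = P (U \<omega>) \<omega>"
      by (simp add: nhds_discrete filterlim_principal)
    then obtain b where b: "U \<omega> < b" "\<And>s. U \<omega> < s \<Longrightarrow> s < b \<Longrightarrow> P s \<omega> = P (U \<omega>) \<omega>"
      unfolding eventually_at_right_field by auto
    have "\<forall>\<^sub>F n in sequentially. T n \<omega> < b"
      using T_lim[OF \<omega>] b(1) by (rule order_tendstoD)
    then show ?thesis
    proof eventually_elim
      case (elim n)
      then show ?case using b(2)[of "T n \<omega>"] T_bounds(1)[OF \<omega>, of n] by (cases "T n \<omega> = U \<omega>") auto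
    qed
  qed
  have PT_meas [measurable]: "(\<lambda>\<omega>. q ^ P (real j / 2 ^ n) \<omega>) \<in> borel_measurable M" for j n
  proof -
    have [measurable]: "P (real j / 2 ^ n) \<in> measurable M (count_space UNIV)" by (rule P_meas) simp
    show ?thesis by measurable
  qed
  have PTJ_meas [measurable]: "(\<lambda>\<omega>. q ^ P (T n \<omega>) \<omega>) \<in> borel_measurable M" for n
    unfolding T_def
    by (rule measurable_compose_countable[where f = "\<lambda>j \<omega>. q ^ P (real j / 2 ^ n) \<omega>", OF PT_meas J_meas])
  have q_lim: "(\<lambda>n. q ^ P (T n \<omega>) \<omega>) \<longlonglongrightarrow> q ^ P (U \<omega>) \<omega>" if "\<omega> \<in> space M" for \<omega>
    using P_lim[OF that] by (intro tendsto_eventually) (auto elim: eventually_mono)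
  have PU_meas [measurable]: "(\<lambda>\<omega>. q ^ P (U \<omega>) \<omega>) \<in> borel_measurable M"
    by (rule borel_measurable_LIMSEQ_real[OF q_lim PTJ_meas])
  have step: "(\<integral>\<^sup>+\<omega>. ennreal (q ^ P (T n \<omega>) \<omega>) \<partial>M) = (\<integral>\<^sup>+\<omega>. ennreal (exp (- (T n \<omega> * (1 - q)))) \<partial>M)" for n
    unfolding T_def
  proof (rule nn_integral_random_index[where f = "\<lambda>j \<omega>. ennreal (q ^ P (real j / 2 ^ n) \<omega>)"
        and g = "\<lambda>j. ennreal (exp (- (real j / 2 ^ n * (1 - q))))"])
    fix j
    have eqJ: "{\<omega>\<in>space M. J n \<omega> = j} = U -` {u. nat \<lceil>2 ^ n * u\<rceil> = j} \<inter> space M"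
      by (auto simp: J_def)
    have B: "{u::real. nat \<lceil>2 ^ n * u\<rceil> = j} \<in> sets borel" by measurable
    show "(\<integral>\<^sup>+\<omega>. ennreal (q ^ P (real j / 2 ^ n) \<omega>) * indicator {\<omega>\<in>space M. J n \<omega> = j} \<omega> \<partial>M)
        = ennreal (exp (- (real j / 2 ^ n * (1 - q)))) * emeasure M {\<omega>\<in>space M. J n \<omega> = j}"
      unfolding eqJ by (rule poisson_process_generating_function_on_event[OF M P indep _ q(1) B]) simp
  qed measurable
  have "(\<lambda>n. \<integral>\<^sup>+\<omega>. ennreal (q ^ P (T n \<omega>) \<omega>) \<partial>M) \<longlonglongrightarrow> (\<integral>\<^sup>+\<omega>. ennreal (q ^ P (U \<omega>) \<omega>) \<partial>M)"
  proof (rule nn_integral_dominated_convergence[where w = "\<lambda>_. 1"])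
    show "AE \<omega> in M. (\<lambda>n. ennreal (q ^ P (T n \<omega>) \<omega>)) \<longlonglongrightarrow> ennreal (q ^ P (U \<omega>) \<omega>)"
      by (intro AE_I2 tendsto_ennrealI q_lim)
  qed (use q emeasure_space_1 in \<open>auto simp: power_le_one\<close>)
  moreover have "(\<lambda>n. \<integral>\<^sup>+\<omega>. ennreal (exp (- (T n \<omega> * (1 - q)))) \<partial>M) \<longlonglongrightarrow> (\<integral>\<^sup>+\<omega>. ennreal (exp (- (U \<omega> * (1 - q)))) \<partial>M)"
  proof (rule nn_integral_dominated_convergence[where w = "\<lambda>_. 1"])
    show "AE \<omega> in M. (\<lambda>n. ennreal (exp (- (T n \<omega> * (1 - q))))) \<longlonglongrightarrow> ennreal (exp (- (U \<omega> * (1 - q))))"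
      by (intro AE_I2 tendsto_ennrealI tendsto_intros T_lim)
    show "AE \<omega> in M. ennreal (exp (- (T n \<omega> * (1 - q)))) \<le> 1" for n
      using q by (intro AE_I2) (simp add: T_def)
  qed (use emeasure_space_1 in auto)
  ultimately show ?thesis
    unfolding step by (rule LIMSEQ_unique)
qed

lemma (in prob_space) prob_all_ge:
  fixes X :: "nat \<Rightarrow> 'a \<Rightarrow> real"
  assumes X_indep: "indep_vars (\<lambda>_. borel) X UNIV" and F: "\<And>i x. F x = \<P>(\<omega> in M. X i \<omega> < x)"
  shows "prob {\<omega>\<in>space M. \<forall>j<(n::nat). y \<le> X j \<omega>} = (1 - F y) ^ n"
proof (cases "n = 0")
  case True
  then show ?thesis by (simp add: prob_space)
next
  case False
  have [measurable]: "X j \<in> borel_measurable M" for j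
    using X_indep by (simp add: indep_vars_def)
  have "prob (X j -` {y..} \<inter> space M) = 1 - F y" for j
  proof -
    have "X j -` {y..} \<inter> space M = space M - {\<omega>\<in>space M. X j \<omega> < y}" by auto
    then show ?thesis unfolding F[of y j] by (simp add: prob_compl)
  qed
  then have "prob (\<Inter>j\<in>{..<n}. X j -` {y..} \<inter> space M) = (1 - F y) ^ n"
    using indep_varsD[OF X_indep, of "{..<n}" "\<lambda>_. {y..}"] False
    by (simp add: lessThan_empty_iff del: INT_simps)
  moreover have "(\<Inter>j\<in>{..<n}. X j -` {y..} \<inter> space M) = {\<omega>\<in>space M. \<forall>j<n. y \<le> X j \<omega>}"
    using False by auto
  ultimately show ?thesis by simp
qed

lemma emeasure_random_sample_ge:
  fixes N :: "'a \<Rightarrow> nat" and X :: "nat \<Rightarrow> 'a \<Rightarrow> real"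
  assumes M: "prob_space M" and X_indep: "prob_space.indep_vars M (\<lambda>_. borel) X UNIV"
    and F: "\<And>i x. F x = \<P>(\<omega> in M. X i \<omega> < x)"
    and N_indep: "independent_rvs M (count_space UNIV) N (PiM UNIV (\<lambda>_. borel)) (\<lambda>\<omega> i. X i \<omega>)"
  shows "emeasure M {\<omega>\<in>space M. \<forall>j<N \<omega>. y \<le> X j \<omega>} = (\<integral>\<^sup>+\<omega>. ennreal ((1 - F y) ^ N \<omega>) \<partial>M)"
proof -
  interpret prob_space M by fact
  have [measurable]: "X j \<in> borel_measurable M" for j
    using X_indep by (simp add: indep_vars_def)
  have [measurable]: "N \<in> measurable M (count_space UNIV)"
    using N_indep by (simp add: independent_rvs_def)
  let ?G = "\<lambda>n. {\<omega>\<in>space M. \<forall>j<(n::nat). y \<le> X j \<omega>}"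
  have "emeasure M {\<omega>\<in>space M. \<forall>j<N \<omega>. y \<le> X j \<omega>} = (\<integral>\<^sup>+\<omega>. indicator {\<omega>\<in>space M. \<forall>j<N \<omega>. y \<le> X j \<omega>} \<omega> \<partial>M)"
    by (rule nn_integral_indicator[symmetric]) measurable
  also have "\<dots> = (\<integral>\<^sup>+\<omega>. indicator (?G (N \<omega>)) \<omega> \<partial>M)"
    by (rule nn_integral_cong) (auto split: split_indicator)
  also have "\<dots> = (\<integral>\<^sup>+\<omega>. ennreal ((1 - F y) ^ N \<omega>) \<partial>M)"
  proof (rule nn_integral_random_index[where f = "\<lambda>n. indicator (?G n)" and g = "\<lambda>n. ennreal ((1 - F y) ^ n)"])
    fix n :: nat
    let ?T = "{x \<in> space (PiM UNIV (\<lambda>_. borel)). \<forall>j<n. y \<le> (x j :: real)}"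
    have T: "?T \<in> sets (PiM UNIV (\<lambda>_. borel))" by measurable
    have eqs: "(\<lambda>\<omega> i. X i \<omega>) -` ?T \<inter> space M = ?G n" "N -` {n} \<inter> space M = {\<omega>\<in>space M. N \<omega> = n}"
      by (auto simp: space_PiM)
    have "(\<integral>\<^sup>+\<omega>. indicator (?G n) \<omega> * indicator {\<omega>\<in>space M. N \<omega> = n} \<omega> \<partial>M)
        = (\<integral>\<^sup>+\<omega>. indicator (?G n \<inter> {\<omega>\<in>space M. N \<omega> = n}) \<omega> \<partial>M)"
      by (rule nn_integral_cong) (auto split: split_indicator)
    also have "\<dots> = emeasure M (?G n \<inter> {\<omega>\<in>space M. N \<omega> = n})"
      by (rule nn_integral_indicator) measurable
    also have "\<dots> = emeasure M (?G n) * emeasure M {\<omega>\<in>space M. N \<omega> = n}"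
      using independent_rvs_prob[OF M N_indep _ T, of "{n}"] unfolding eqs by simp
    also have "emeasure M (?G n) = ennreal ((1 - F y) ^ n)"
      using prob_all_ge[OF X_indep F] by (simp add: emeasure_eq_measure)
    finally show "(\<integral>\<^sup>+\<omega>. indicator (?G n) \<omega> * indicator {\<omega>\<in>space M. N \<omega> = n} \<omega> \<partial>M)
        = ennreal ((1 - F y) ^ n) * emeasure M {\<omega>\<in>space M. N \<omega> = n}" .
  qed measurable
  finally show ?thesis .
qed

text \<open>
  Given the sample size $n$, the event has probability $(1 - F(y))^n$, and the generating function of
  $P(U)$ at $1 - F(y)$ is $E e^{-U F(y)}$. The quantifier over $j < N$ is true for $N = 0$; this is
  the convention that makes the formula exact.
\<close>

lemma prob_poisson_sample_ge:
  fixes U :: "'a \<Rightarrow> real" and N :: "'a \<Rightarrow> nat" and X :: "nat \<Rightarrow> 'a \<Rightarrow> real"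
  assumes M: "prob_space M" and P: "poisson_process M 1 P"
    and U_nonneg: "\<And>\<omega>. \<omega> \<in> space M \<Longrightarrow> 0 \<le> U \<omega>"
    and U_indep: "independent_rvs M borel U (PiM {0..} (\<lambda>_. count_space UNIV)) (process_path P)"
    and N: "\<And>\<omega>. N \<omega> = P (U \<omega>) \<omega>"
    and X_indep: "prob_space.indep_vars M (\<lambda>_. borel) X UNIV"
    and F: "\<And>i x. F x = \<P>(\<omega> in M. X i \<omega> < x)"
    and N_indep: "independent_rvs M (count_space UNIV) N (PiM UNIV (\<lambda>_. borel)) (\<lambda>\<omega> i. X i \<omega>)"
  shows "\<P>(\<omega> in M. \<forall>j<N \<omega>. y \<le> X j \<omega>) = (\<integral>\<omega>. exp (- (U \<omega> * F y)) \<partial>M)"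
proof -
  interpret prob_space M by fact
  have [measurable]: "U \<in> borel_measurable M" using U_indep by (simp add: independent_rvs_def)
  have Fb: "0 \<le> F y" "F y \<le> 1" unfolding F[of y 0] by simp_all
  have "emeasure M {\<omega>\<in>space M. \<forall>j<N \<omega>. y \<le> X j \<omega>} = (\<integral>\<^sup>+\<omega>. ennreal ((1 - F y) ^ N \<omega>) \<partial>M)"
    by (rule emeasure_random_sample_ge[OF M X_indep F N_indep])
  also have "\<dots> = (\<integral>\<^sup>+\<omega>. ennreal (exp (- (U \<omega> * F y))) \<partial>M)"
    using poisson_process_at_independent_time[OF M P U_nonneg U_indep, of "1 - F y"] Fb
    unfolding N by simp
  also have "\<dots> = ennreal (\<integral>\<omega>. exp (- (U \<omega> * F y)) \<partial>M)"
    using Fb U_nonneg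
    by (intro nn_integral_eq_integral integrable_const_bound[where B=1] AE_I2) auto
  finally show ?thesis
    by (simp add: emeasure_eq_measure)
qed

section \<open>Regular variation and the scaling constants\<close>

text \<open>
  The substitution $y = -1/t$ turns the behaviour of $A_F$ at $-\<infinity>$ into regular variation of
  $t \<mapsto> F(a + t)$ at $0$ from the right.
\<close>

lemma weibull_min_domain_regularly_varying:
  assumes "weibull_min_domain \<gamma> F" and x: "0 < x"
  defines "a \<equiv> real_of_ereal (lext F)"
  shows "((\<lambda>t. F (a + x * t) / F (a + t)) \<longlongrightarrow> x powr \<gamma>) (at_right 0)"
proof -
  have lim: "((\<lambda>y. A_fun F (y * (1 / x)) / A_fun F y) \<longlongrightarrow> (1 / x) powr (- \<gamma>)) at_bot"
    using assms(1) x unfolding weibull_min_domain_def by (meson zero_less_divide_1_iff)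
  have sub: "filterlim (\<lambda>t::real. - 1 / t) at_bot (at_right 0)" by real_asymp
  have "((\<lambda>t. A_fun F (- 1 / t * (1 / x)) / A_fun F (- 1 / t)) \<longlongrightarrow> (1 / x) powr (- \<gamma>)) (at_right 0)"
    by (rule filterlim_compose[OF lim sub])
  moreover have "(1 / x) powr (- \<gamma>) = x powr \<gamma>"
    using x by (simp add: powr_divide powr_minus field_simps)
  ultimately show ?thesis by (simp add: A_fun_def a_def mult.commute)
qed

lemma weibull_min_domain_lext_finite:
  assumes "weibull_min_domain \<gamma> F" and "0 < F x0"
  shows "lext F = ereal (real_of_ereal (lext F))"
proof -
  have "lext F \<le> ereal x0" using assms(2) unfolding lext_def by (intro Inf_lower) auto
  then show ?thesis using assms(1) by (cases "lext F") (auto simp: weibull_min_domain_def)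
qed

lemma pos_right_of_lext:
  assumes "mono F" and "lext F = ereal a" and "0 < t"
  shows "0 < F (a + t)"
proof -
  have "lext F < ereal (a + t)" using assms by simp
  then obtain x where "0 < F x" "x < a + t"
    unfolding lext_def by (auto simp: Inf_less_iff)
  then show ?thesis using monoD[OF assms(1), of x "a + t"] by simp
qed

text \<open>
  $F(a+t)$ tends to $0$ with $t$: halving $t$ multiplies $F(a+t)$ by a factor that is eventually
  below some $q < 1$, since $2^{-\<gamma>} < 1$.
\<close>

lemma weibull_min_domain_small_values:
  assumes "mono F" and dom: "weibull_min_domain \<gamma> F" and \<gamma>: "0 < \<gamma>"
    and a: "lext F = ereal a" and \<epsilon>: "0 < \<epsilon>"
  obtains t where "0 < t" "F (a + t) \<le> \<epsilon>"
proof -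
  have F_pos: "0 < F (a + t)" if "0 < t" for t
    by (rule pos_right_of_lext[OF assms(1) a that])
  obtain q where q: "(1/2) powr \<gamma> < q" "q < (1::real)"
    using dense[of "(1/2::real) powr \<gamma>" 1] powr_less_mono2[of \<gamma> "1/2" 1] \<gamma> by auto
  then have q0: "0 < q" by (meson le_less_trans powr_ge_zero)
  have "((\<lambda>t. F (a + (1/2) * t) / F (a + t)) \<longlongrightarrow> (1/2) powr \<gamma>) (at_right 0)"
    using weibull_min_domain_regularly_varying[OF dom, of "1/2"] a by simp
  then have "\<forall>\<^sub>F t in at_right 0. F (a + (1/2) * t) / F (a + t) < q"
    using q(1) by (rule order_tendstoD)
  then obtain c where c: "0 < c" "\<And>t. 0 < t \<Longrightarrow> t < c \<Longrightarrow> F (a + (1/2) * t) / F (a + t) < q"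
    unfolding eventually_at_right_field by auto
  define t where "t n = c / 2 / 2 ^ n" for n :: nat
  have t: "0 < t n" "t n < c" for n
  proof -
    show "0 < t n" using c by (simp add: t_def)
    have "c / 2 / 2 ^ n \<le> c / 2 / 1" using c by (intro divide_left_mono) auto
    then show "t n < c" using c by (simp add: t_def)
  qed
  have decay: "F (a + t n) \<le> q ^ n * F (a + t 0)" for n
  proof (induction n)
    case (Suc n)
    have "t (Suc n) = (1/2) * t n" by (simp add: t_def)
    then have "F (a + t (Suc n)) < q * F (a + t n)"
      using c(2)[OF t[of n]] F_pos[OF t(1)[of n]] by (simp only: pos_divide_less_eq)
    also have "\<dots> \<le> q * (q ^ n * F (a + t 0))" using Suc q0 by (intro mult_left_mono) auto
    finally show ?case by simp
  qed simp
  have "(\<lambda>n. q ^ n * F (a + t 0)) \<longlonglongrightarrow> 0"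
    using q q0 by (intro tendsto_mult_left_zero LIMSEQ_realpow_zero) auto
  then have "\<forall>\<^sub>F n in sequentially. q ^ n * F (a + t 0) < \<epsilon>"
    using \<epsilon> by (rule order_tendstoD)
  then obtain n where "q ^ n * F (a + t 0) < \<epsilon>"
    by (auto simp: eventually_sequentially)
  then show ?thesis using decay[of n] t(1)[of n] that[of "t n"] by simp
qed

lemma min_scale_pos:
  assumes "mono F" and "weibull_min_domain \<gamma> F" and "0 < \<gamma>" and a: "lext F = ereal a" and "0 < d"
  shows "0 < min_scale F d"
proof -
  obtain t where t: "0 < t" "F (a + t) \<le> 1 / d"
    using weibull_min_domain_small_values[OF assms(1-4), of "1 / d"] assms(5) by auto
  have "ereal a < ereal (a + t)" using t(1) by simp
  also have "\<dots> \<le> Sup (ereal ` {x. F x \<le> 1 / d})" using t(2) by (intro Sup_upper) auto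
  finally have "ereal a < Sup (ereal ` {x. F x \<le> 1 / d})" .
  then show ?thesis unfolding min_scale_def a
    by (cases "Sup (ereal ` {x. F x \<le> 1 / d})") auto
qed

lemma min_scale_le:
  assumes "mono F" and a: "lext F = ereal a" and t: "1 / d < F (a + t)"
  shows "min_scale F d \<le> ereal t"
proof -
  have "Sup (ereal ` {x. F x \<le> 1 / d}) \<le> ereal (a + t)"
  proof (rule Sup_least, clarify)
    fix x assume "F x \<le> 1 / d"
    then show "ereal x \<le> ereal (a + t)"
      using t monoD[OF assms(1), of "a + t" x] by (simp add: not_less) (meson le_less_trans linorder_le_cases not_less)
  qed
  then show ?thesis unfolding min_scale_def a
    by (cases "Sup (ereal ` {x. F x \<le> 1 / d})") auto
qed

lemma le_of_less_min_scale:
  assumes "mono F" and a: "lext F = ereal a" and t: "ereal t < min_scale F d"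
  shows "F (a + t) \<le> 1 / d"
proof -
  have "ereal (a + t) < Sup (ereal ` {x. F x \<le> 1 / d})"
    using t unfolding min_scale_def a
    by (cases "Sup (ereal ` {x. F x \<le> 1 / d})") auto
  then obtain x where "F x \<le> 1 / d" "a + t < x" by (auto simp: less_Sup_iff)
  then show ?thesis using monoD[OF assms(1), of "a + t" x] by simp
qed

lemma less_of_min_scale_less:
  assumes a: "lext F = ereal a" and t: "min_scale F d < ereal t"
  shows "1 / d < F (a + t)"
proof (rule ccontr)
  assume "\<not> 1 / d < F (a + t)"
  then have "ereal (a + t) \<le> Sup (ereal ` {x. F x \<le> 1 / d})" by (intro Sup_upper) auto
  then show False using t unfolding min_scale_def a
    by (cases "Sup (ereal ` {x. F x \<le> 1 / d})") auto
qed

lemma min_scale_eventually: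
  assumes "mono F" and "weibull_min_domain \<gamma> F" and "0 < \<gamma>" and a: "lext F = ereal a"
    and d_pos: "\<And>k. 0 < d k" and d_lim: "filterlim d at_top sequentially" and \<epsilon>: "0 < \<epsilon>"
  shows "\<forall>\<^sub>F k in sequentially. min_scale F (d k) \<le> ereal \<epsilon>"
proof -
  have F\<epsilon>: "0 < F (a + \<epsilon>)" by (rule pos_right_of_lext[OF assms(1) a \<epsilon>])
  have "\<forall>\<^sub>F k in sequentially. 1 / F (a + \<epsilon>) < d k"
    using d_lim by (simp add: filterlim_at_top_dense)
  then show ?thesis
  proof eventually_elim
    case (elim k)
    then have "1 / d k < F (a + \<epsilon>)" using F\<epsilon> d_pos[of k] by (simp add: field_simps)
    then show ?case by (rule min_scale_le[OF assms(1) a])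
  qed
qed

text \<open>
  For $s < 1 < s'$ the definition of $b_k$ as a quantile gives, for large $k$,
  $d_k F(a + s b_k) \<le> 1 < d_k F(a + s' b_k)$, so that $d_k F(a + b_k x)$ lies between
  $F(a + b_k x)/F(a + s' b_k)$ and $F(a + b_k x)/F(a + s b_k)$. By regular variation these tend
  to $(x/s')^\<gamma>$ and $(x/s)^\<gamma>$, and both are close to $x^\<gamma>$ when $s$ and $s'$ are close to $1$.
\<close>

lemma min_scale_normalizes:
  assumes mono: "mono F" and dom: "weibull_min_domain \<gamma> F" and \<gamma>: "0 < \<gamma>" and a: "lext F = ereal a"
    and d_pos: "\<And>k. 0 < d k" and d_lim: "filterlim d at_top sequentially" and x: "0 < x"
  defines "b \<equiv> \<lambda>k. real_of_ereal (min_scale F (d k))"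
  shows "(\<lambda>k. d k * F (a + b k * x)) \<longlonglongrightarrow> x powr \<gamma>"
proof -
  have F_pos: "0 < F (a + t)" if "0 < t" for t
    by (rule pos_right_of_lext[OF mono a that])
  have scale_pos: "0 < min_scale F (d k)" for k
    by (rule min_scale_pos[OF mono dom \<gamma> a d_pos])
  have scale_le: "\<forall>\<^sub>F k in sequentially. min_scale F (d k) \<le> ereal \<epsilon>" if "0 < \<epsilon>" for \<epsilon>
    by (rule min_scale_eventually[OF mono dom \<gamma> a d_pos d_lim that])
  have scale_b: "\<forall>\<^sub>F k in sequentially. min_scale F (d k) = ereal (b k) \<and> 0 < b k"
    using scale_le[OF zero_less_one]
  proof eventually_elim
    case (elim k)
    then show ?case using scale_pos[of k] by (cases "min_scale F (d k)") (auto simp: b_def)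
  qed
  have b_lim: "filterlim b (at_right 0) sequentially"
    unfolding filterlim_at
  proof (intro conjI order_tendstoI)
    show "\<forall>\<^sub>F k in sequentially. b k \<in> {0<..} \<and> b k \<noteq> 0"
      using scale_b by eventually_elim simp
    show "\<forall>\<^sub>F k in sequentially. l < b k" if "l < 0" for l
      using scale_b by eventually_elim (use that in simp)
    show "\<forall>\<^sub>F k in sequentially. b k < u" if "0 < u" for u
    proof -
      have "\<forall>\<^sub>F k in sequentially. min_scale F (d k) \<le> ereal (u / 2)"
        using that by (intro scale_le) simp
      then show ?thesis using scale_b by eventually_elim (use that in simp)
    qed
  qed
  have ratio: "(\<lambda>k. F (a + x * b k) / F (a + s * b k)) \<longlonglongrightarrow> (x / s) powr \<gamma>" if s: "0 < s" for s
  proof -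
    have sb: "filterlim (\<lambda>k. s * b k) (at_right 0) sequentially"
      using s b_lim by (auto simp: filterlim_at intro!: tendsto_eq_intros elim!: eventually_mono)
    have "((\<lambda>t. F (a + x / s * t) / F (a + t)) \<longlongrightarrow> (x / s) powr \<gamma>) (at_right 0)"
      using weibull_min_domain_regularly_varying[OF dom, of "x / s"] a x s by simp
    from filterlim_compose[OF this sb]
    have "(\<lambda>k. F (a + x / s * (s * b k)) / F (a + s * b k)) \<longlonglongrightarrow> (x / s) powr \<gamma>" .
    then show ?thesis using s by simp
  qed
  have cont: "((\<lambda>s. (x / s) powr \<gamma>) \<longlongrightarrow> x powr \<gamma>) (at 1)"
    using x by (auto intro!: tendsto_eq_intros)
  show ?thesis
  proof (rule order_tendstoI)
    fix l assume "l < x powr \<gamma>"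
    with cont have "\<forall>\<^sub>F s in at_right 1. l < (x / s) powr \<gamma>"
      by (intro order_tendstoD(1)) (auto intro: filterlim_mono at_le)
    then obtain c where c: "1 < c" "\<And>s. 1 < s \<Longrightarrow> s < c \<Longrightarrow> l < (x / s) powr \<gamma>"
      unfolding eventually_at_right_field by auto
    obtain s where "1 < s" "s < c" using dense[OF c(1)] by blast
    then have s: "1 < s" "l < (x / s) powr \<gamma>" using c(2) by auto
    then have "\<forall>\<^sub>F k in sequentially. l < F (a + x * b k) / F (a + s * b k)"
      using order_tendstoD(1)[OF ratio[of s] s(2)] by simp
    with scale_b show "\<forall>\<^sub>F k in sequentially. l < d k * F (a + b k * x)"
    proof eventually_elim
      case (elim k)
      then have "1 / d k < F (a + s * b k)"
        using s by (intro less_of_min_scale_less[OF a]) simp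
      moreover have "0 < F (a + s * b k)" "0 < F (a + x * b k)" using elim s x by (auto intro!: F_pos)
      ultimately have "F (a + x * b k) / F (a + s * b k) \<le> d k * F (a + x * b k)"
        using d_pos[of k] by (simp add: field_simps)
      then show ?case using elim by (simp add: mult.commute)
    qed
  next
    fix u assume "x powr \<gamma> < u"
    with cont have "\<forall>\<^sub>F s in at_left 1. (x / s) powr \<gamma> < u"
      by (intro order_tendstoD(2)) (auto intro: filterlim_mono at_le)
    then obtain c where c: "c < 1" "\<And>s. c < s \<Longrightarrow> s < 1 \<Longrightarrow> (x / s) powr \<gamma> < u"
      unfolding eventually_at_left_field by auto
    have "max c 0 < 1" using c(1) by simp
    then obtain s where "max c 0 < s" "s < 1" using dense by blast
    then have s: "0 < s" "s < 1" "(x / s) powr \<gamma> < u" using c(2) by auto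
    then have "\<forall>\<^sub>F k in sequentially. F (a + x * b k) / F (a + s * b k) < u"
      using order_tendstoD(2)[OF ratio[of s] s(3)] by simp
    with scale_b show "\<forall>\<^sub>F k in sequentially. d k * F (a + b k * x) < u"
    proof eventually_elim
      case (elim k)
      then have "F (a + s * b k) \<le> 1 / d k"
        using s by (intro le_of_less_min_scale[OF mono a]) simp
      moreover have "0 < F (a + s * b k)" "0 < F (a + x * b k)" using elim s x by (auto intro!: F_pos)
      ultimately have "d k * F (a + x * b k) \<le> F (a + x * b k) / F (a + s * b k)"
        using d_pos[of k] by (simp add: field_simps)
      then show ?case using elim by (simp add: mult.commute)
    qed
  qed
qed

section \<open>Convergence in distribution of the normalised minima\<close>

text \<open>
  The coefficient in the exponent varies with $k$, so the test function is not fixed; on the probability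
  space of Skorohod's theorem both factors converge pointwise and dominated convergence applies.
\<close>

lemma converges_in_distribution_exp:
  fixes V :: "nat \<Rightarrow> 'a \<Rightarrow> real" and W :: "'b \<Rightarrow> real"
  assumes M: "prob_space M" and Q: "prob_space Q" and W [measurable]: "W \<in> borel_measurable Q"
    and conv: "converges_in_distribution M V (distr Q borel W)"
    and V_nonneg: "\<And>k \<omega>. \<omega> \<in> space M \<Longrightarrow> 0 \<le> V k \<omega>"
    and c: "c \<longlonglongrightarrow> c0" and c_nonneg: "\<And>k. 0 \<le> c k"
  shows "(\<lambda>k. \<integral>\<omega>. exp (- (c k * V k \<omega>)) \<partial>M) \<longlonglongrightarrow> (\<integral>\<omega>. exp (- (c0 * W \<omega>)) \<partial>Q)"
proof -
  interpret M: prob_space M by fact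
  interpret Q: prob_space Q by fact
  have [measurable]: "V k \<in> borel_measurable M" for k
    using conv by (simp add: converges_in_distribution_def)
  have V_law: "real_distribution (distr M borel (V k))" for k
    by (rule M.real_distribution_distr) measurable
  have W_law: "real_distribution (distr Q borel W)"
    by (rule Q.real_distribution_distr) measurable
  have weak: "weak_conv_m (\<lambda>k. distr M borel (V k)) (distr Q borel W)"
    using conv by (simp add: converges_in_distribution_def)
  obtain \<Omega> :: "real measure" and Y and Y0 where \<Omega>: "prob_space \<Omega>"
    and Y [measurable]: "\<And>k. Y k \<in> borel_measurable \<Omega>" and Y_law: "\<And>k. distr \<Omega> borel (Y k) = distr M borel (V k)"
    and Y0: "Y0 \<in> measurable \<Omega> lborel" and Y0_law: "distr \<Omega> borel Y0 = distr Q borel W"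
    and Y_lim: "\<And>x. x \<in> space \<Omega> \<Longrightarrow> (\<lambda>k. Y k x) \<longlonglongrightarrow> Y0 x"
    using Skorohod[OF V_law W_law weak] by metis
  interpret \<Omega>: prob_space \<Omega> by fact
  have [measurable]: "Y0 \<in> borel_measurable \<Omega>" using Y0 by simp
  have Y_nonneg: "AE x in \<Omega>. 0 \<le> Y k x" for k
  proof -
    have "AE v in distr M borel (V k). 0 \<le> v" by (subst AE_distr_iff) (auto simp: V_nonneg)
    then have "AE v in distr \<Omega> borel (Y k). 0 \<le> v" by (simp only: Y_law)
    then show ?thesis by (subst (asm) AE_distr_iff) auto
  qed
  have eq: "(\<integral>\<omega>. exp (- (r * V k \<omega>)) \<partial>M) = (\<integral>x. exp (- (r * Y k x)) \<partial>\<Omega>)" for r k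
  proof -
    have "(\<integral>\<omega>. exp (- (r * V k \<omega>)) \<partial>M) = (\<integral>v. exp (- (r * v)) \<partial>distr M borel (V k))"
      by (subst integral_distr) auto
    also have "\<dots> = (\<integral>v. exp (- (r * v)) \<partial>distr \<Omega> borel (Y k))" by (simp only: Y_law)
    also have "\<dots> = (\<integral>x. exp (- (r * Y k x)) \<partial>\<Omega>)" by (subst integral_distr) auto
    finally show ?thesis .
  qed
  have eq0: "(\<integral>\<omega>. exp (- (c0 * W \<omega>)) \<partial>Q) = (\<integral>x. exp (- (c0 * Y0 x)) \<partial>\<Omega>)"
  proof -
    have "(\<integral>\<omega>. exp (- (c0 * W \<omega>)) \<partial>Q) = (\<integral>v. exp (- (c0 * v)) \<partial>distr Q borel W)"
      by (subst integral_distr) auto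
    also have "\<dots> = (\<integral>v. exp (- (c0 * v)) \<partial>distr \<Omega> borel Y0)" by (simp only: Y0_law)
    also have "\<dots> = (\<integral>x. exp (- (c0 * Y0 x)) \<partial>\<Omega>)" by (subst integral_distr) auto
    finally show ?thesis .
  qed
  show ?thesis unfolding eq eq0
  proof (rule integral_dominated_convergence[where w = "\<lambda>_. 1"])
    show "AE x in \<Omega>. (\<lambda>k. exp (- (c k * Y k x))) \<longlonglongrightarrow> exp (- (c0 * Y0 x))"
      by (intro AE_I2 tendsto_intros c Y_lim)
    show "AE x in \<Omega>. norm (exp (- (c k * Y k x))) \<le> 1" for k
      using Y_nonneg[of k] by eventually_elim (simp add: c_nonneg)
  qed auto
qed

lemma sample_min_measurable:
  assumes X: "\<And>j. X j \<in> borel_measurable M" and N: "N \<in> measurable M (count_space UNIV)"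
  shows "(\<lambda>\<omega>. sample_min X (N \<omega>) \<omega>) \<in> borel_measurable M"
proof (rule measurable_compose_countable[where f = "\<lambda>n \<omega>. sample_min X n \<omega>", OF _ N])
  fix n
  show "(\<lambda>\<omega>. sample_min X n \<omega>) \<in> borel_measurable M"
  proof (cases "n = 0")
    case False
    then show ?thesis unfolding sample_min_def using X by (simp add: borel_measurable_Min)
  qed (simp add: sample_min_def)
qed

lemma sample_min_ge_iff: "0 < n \<Longrightarrow> y \<le> sample_min X n \<omega> \<longleftrightarrow> (\<forall>j<n. y \<le> X j \<omega>)"
  by (auto simp: sample_min_def lessThan_empty_iff)

text \<open>
  The event in the hypothesis and the event that the normalised minimum is at least $x$ differ only when
  the sample is empty. The probability of an empty sample tends to $0$: it is below the probability in
  the hypothesis for every $x$, and \<open>1 - cdf \<mu> x\<close> vanishes as $x \<rightarrow> \<infinity>$. The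
  points $x \<le> 0$ are covered by monotonicity, because the limit law has no mass there.
\<close>

lemma converges_in_distribution_sample_min:
  fixes X :: "nat \<Rightarrow> 'a \<Rightarrow> real" and N :: "nat \<Rightarrow> 'a \<Rightarrow> nat"
  assumes M: "prob_space M" and \<mu>: "real_distribution \<mu>" and pos: "AE x in \<mu>. 0 < x"
    and X [measurable]: "\<And>j. X j \<in> borel_measurable M"
    and N [measurable]: "\<And>k. N k \<in> measurable M (count_space UNIV)"
    and b: "\<forall>\<^sub>F k in sequentially. 0 < b k"
    and lim: "\<And>x. 0 < x \<Longrightarrow> (\<lambda>k. \<P>(\<omega> in M. \<forall>j<N k \<omega>. a + b k * x \<le> X j \<omega>)) \<longlonglongrightarrow> 1 - cdf \<mu> x"
  shows "converges_in_distribution M (\<lambda>k \<omega>. (sample_min X (N k \<omega>) \<omega> - a) / b k) \<mu>"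
proof -
  interpret prob_space M by fact
  interpret \<mu>: real_distribution \<mu> by fact
  have min_meas [measurable]: "(\<lambda>\<omega>. sample_min X (N k \<omega>) \<omega>) \<in> borel_measurable M" for k
    by (intro sample_min_measurable X N)
  define Z where "Z k \<omega> = (sample_min X (N k \<omega>) \<omega> - a) / b k" for k \<omega>
  have Z_meas [measurable]: "Z k \<in> borel_measurable M" for k unfolding Z_def by measurable
  define g where "g k x = prob {\<omega>\<in>space M. \<forall>j<N k \<omega>. a + b k * x \<le> X j \<omega>}" for k x
  define p0 where "p0 k = prob {\<omega>\<in>space M. N k \<omega> = 0}" for k
  have g_lim: "(\<lambda>k. g k x) \<longlonglongrightarrow> 1 - cdf \<mu> x" if "0 < x" for x
    using lim[OF that] by (simp add: g_def)
  have cdf_nonpos: "cdf \<mu> x = 0" if "x \<le> 0" for x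
  proof -
    have "AE y in \<mu>. y \<notin> {..x}" using pos by eventually_elim (use that in auto)
    then have "emeasure \<mu> {..x} = 0" by (subst (asm) AE_iff_measurable[of "{..x}"]) auto
    then show ?thesis by (simp add: cdf_def measure_def)
  qed
  have p0_le: "p0 k \<le> g k x" for k x
    unfolding p0_def g_def by (rule finite_measure_mono) auto
  have p0_lim: "p0 \<longlonglongrightarrow> 0"
  proof (rule order_tendstoI)
    show "\<forall>\<^sub>F k in sequentially. l < p0 k" if "l < 0" for l
      using that by (intro always_eventually) (auto simp: p0_def intro: less_le_trans)
    show "\<forall>\<^sub>F k in sequentially. p0 k < u" if "0 < u" for u
    proof -
      have "\<forall>\<^sub>F x in at_top. 1 - u < cdf \<mu> x"
        using \<mu>.cdf_lim_at_top_prob that by (intro order_tendstoD) auto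
      then have "\<forall>\<^sub>F x in at_top. 1 - u < cdf \<mu> x \<and> 0 < x"
        using eventually_gt_at_top[of 0] by eventually_elim simp
      then obtain x where x: "1 - u < cdf \<mu> x" "0 < x"
        by (auto simp: eventually_at_top_linorder)
      have "\<forall>\<^sub>F k in sequentially. g k x < u"
        using x by (intro order_tendstoD(2)[OF g_lim]) auto
      then show ?thesis by eventually_elim (use p0_le le_less_trans in blast)
    qed
  qed
  have compl: "prob {\<omega>\<in>space M. \<not> (\<forall>j<N k \<omega>. a + b k * y \<le> X j \<omega>)} = 1 - g k y" for k y
  proof -
    have "{\<omega>\<in>space M. \<not> (\<forall>j<N k \<omega>. a + b k * y \<le> X j \<omega>)} = space M - {\<omega>\<in>space M. \<forall>j<N k \<omega>. a + b k * y \<le> X j \<omega>}"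
      by auto
    then show ?thesis unfolding g_def by (simp only:) (rule prob_compl, measurable)
  qed
  have upper: "prob {\<omega>\<in>space M. Z k \<omega> \<le> x} \<le> 1 - g k y + p0 k" if "0 < b k" "x < y" for k x y
  proof -
    have "{\<omega>\<in>space M. Z k \<omega> \<le> x} \<subseteq> {\<omega>\<in>space M. \<not> (\<forall>j<N k \<omega>. a + b k * y \<le> X j \<omega>)} \<union> {\<omega>\<in>space M. N k \<omega> = 0}"
    proof (rule subsetI, rule ccontr)
      fix \<omega> assume \<omega>: "\<omega> \<in> {\<omega>\<in>space M. Z k \<omega> \<le> x}"
        and "\<omega> \<notin> {\<omega>\<in>space M. \<not> (\<forall>j<N k \<omega>. a + b k * y \<le> X j \<omega>)} \<union> {\<omega>\<in>space M. N k \<omega> = 0}"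
      then have "\<forall>j<N k \<omega>. a + b k * y \<le> X j \<omega>" "0 < N k \<omega>" by auto
      then have "a + b k * y \<le> sample_min X (N k \<omega>) \<omega>" by (simp add: sample_min_ge_iff)
      then have "y \<le> Z k \<omega>" using that(1) by (simp add: Z_def field_simps)
      then show False using \<omega> that(2) by simp
    qed
    then have "prob {\<omega>\<in>space M. Z k \<omega> \<le> x} \<le> prob ({\<omega>\<in>space M. \<not> (\<forall>j<N k \<omega>. a + b k * y \<le> X j \<omega>)} \<union> {\<omega>\<in>space M. N k \<omega> = 0})"
      by (intro finite_measure_mono) auto
    also have "\<dots> \<le> 1 - g k y + p0 k"
      unfolding compl[symmetric] p0_def by (intro measure_Un_le) measurable
    finally show ?thesis .
  qed
  have lower: "1 - g k x - p0 k \<le> prob {\<omega>\<in>space M. Z k \<omega> \<le> x}" if "0 < b k" for k x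
  proof -
    have "{\<omega>\<in>space M. \<not> (\<forall>j<N k \<omega>. a + b k * x \<le> X j \<omega>)} \<subseteq> {\<omega>\<in>space M. Z k \<omega> \<le> x}"
    proof (rule subsetI)
      fix \<omega> assume \<omega>: "\<omega> \<in> {\<omega>\<in>space M. \<not> (\<forall>j<N k \<omega>. a + b k * x \<le> X j \<omega>)}"
      then have "0 < N k \<omega>" by auto
      then have "\<not> a + b k * x \<le> sample_min X (N k \<omega>) \<omega>"
        using \<omega> by (simp add: sample_min_ge_iff)
      then have "Z k \<omega> \<le> x" using that by (simp add: Z_def field_simps)
      then show "\<omega> \<in> {\<omega>\<in>space M. Z k \<omega> \<le> x}" using \<omega> by simp
    qed
    then have "prob {\<omega>\<in>space M. \<not> (\<forall>j<N k \<omega>. a + b k * x \<le> X j \<omega>)} \<le> prob {\<omega>\<in>space M. Z k \<omega> \<le> x}"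
      by (intro finite_measure_mono) auto
    moreover have "0 \<le> p0 k" by (simp add: p0_def)
    ultimately show ?thesis unfolding compl by simp
  qed
  have cdf_lim: "(\<lambda>k. prob {\<omega>\<in>space M. Z k \<omega> \<le> x}) \<longlonglongrightarrow> cdf \<mu> x" for x
  proof (rule order_tendstoI)
    fix l assume l: "l < cdf \<mu> x"
    show "\<forall>\<^sub>F k in sequentially. l < prob {\<omega>\<in>space M. Z k \<omega> \<le> x}"
    proof (cases "0 < x")
      case True
      have "(\<lambda>k. 1 - g k x - p0 k) \<longlonglongrightarrow> cdf \<mu> x"
        using tendsto_diff[OF tendsto_diff[OF tendsto_const g_lim[OF True]] p0_lim, of 1] by simp
      then have "\<forall>\<^sub>F k in sequentially. l < 1 - g k x - p0 k" using l by (rule order_tendstoD)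
      then show ?thesis using b by eventually_elim (use lower less_le_trans in blast)
    next
      case False
      then show ?thesis using l cdf_nonpos[of x] by (intro always_eventually) (auto intro: less_le_trans)
    qed
  next
    \<comment> \<open>Passing to a slightly larger positive y replaces the weak inequality by a strict one and reduces x \<le> 0 to the positive case.\<close>
    fix u assume u: "cdf \<mu> x < u"
    have "cdf \<mu> (max x 0) < u" using u cdf_nonpos[of x] cdf_nonpos[of 0] by (cases "0 < x") (auto simp: max_def)
    moreover have "(cdf \<mu> \<longlongrightarrow> cdf \<mu> (max x 0)) (at_right (max x 0))"
      using \<mu>.cdf_is_right_cont by (simp add: continuous_within)
    ultimately have "\<forall>\<^sub>F y in at_right (max x 0). cdf \<mu> y < u"
      by (intro order_tendstoD)
    then obtain c where c: "max x 0 < c" "\<And>y. max x 0 < y \<Longrightarrow> y < c \<Longrightarrow> cdf \<mu> y < u"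
      unfolding eventually_at_right_field by auto
    then obtain y where y: "max x 0 < y" "cdf \<mu> y < u" using dense[of "max x 0" c] by auto
    have "(\<lambda>k. 1 - g k y + p0 k) \<longlonglongrightarrow> cdf \<mu> y"
      using tendsto_add[OF tendsto_diff[OF tendsto_const g_lim] p0_lim, of y 1] y by simp
    then have "\<forall>\<^sub>F k in sequentially. 1 - g k y + p0 k < u" using y(2) by (rule order_tendstoD)
    with b show "\<forall>\<^sub>F k in sequentially. prob {\<omega>\<in>space M. Z k \<omega> \<le> x} < u"
    proof eventually_elim
      case (elim k)
      have "x < y" using y(1) by simp
      from upper[OF elim(1) this] elim(2) show ?case by (rule le_less_trans)
    qed
  qed
  have "cdf (distr M borel (Z k)) x = prob {\<omega>\<in>space M. Z k \<omega> \<le> x}" for k x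
  proof -
    have "Z k -` {..x} \<inter> space M = {\<omega>\<in>space M. Z k \<omega> \<le> x}" by auto
    then show ?thesis by (simp add: cdf_def measure_distr)
  qed
  then have "weak_conv_m (\<lambda>k. distr M borel (Z k)) \<mu>"
    unfolding weak_conv_m_def weak_conv_def using cdf_lim by simp
  then show ?thesis
    using Z_meas unfolding converges_in_distribution_def Z_def by simp
qed

theorem theorem6:
  fixes \<delta> \<delta>' :: real
    and M :: "'a measure" and P :: "real \<Rightarrow> 'a \<Rightarrow> nat"
    and U :: "nat \<Rightarrow> 'a \<Rightarrow> real" and N :: "nat \<Rightarrow> 'a \<Rightarrow> nat"
    and X :: "nat \<Rightarrow> 'a \<Rightarrow> real" and F :: "real \<Rightarrow> real"
    and \<mu> :: "real measure"
    and Q :: "'b measure" and S K :: "'b \<Rightarrow> real"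
    and d :: "nat \<Rightarrow> real"
  assumes delta: "0 < \<delta>" "\<delta> < 1"
    and M: "prob_space M"
    and P: "poisson_process M 1 P"
    and U_nonneg: "\<And>k \<omega>. \<omega> \<in> space M \<Longrightarrow> 0 \<le> U k \<omega>"
    and U_incr: "infinitely_increasing M U"
    and U_indep: "\<And>k. independent_rvs M borel (U k)
                      (PiM {0..} (\<lambda>_. count_space UNIV)) (process_path P)"
    and N: "\<And>k \<omega>. N k \<omega> = P (U k \<omega>) \<omega>"
    and X_indep: "prob_space.indep_vars M (\<lambda>_. borel) X UNIV"
    and X_distr: "\<And>i. distr M borel (X i) = distr M borel (X 0)"
    and F: "\<And>i x. F x = \<P>(\<omega> in M. X i \<omega> < x)"
    and N_indep: "\<And>k. independent_rvs M (count_space UNIV) (N k)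
                      (PiM UNIV (\<lambda>_. borel)) (\<lambda>\<omega> i. X i \<omega>)"
    and mu: "mittag_leffler_law \<delta> \<mu>"
    and delta': "\<delta> < \<delta>'" "\<delta>' \<le> 1"
    and F_domain: "weibull_min_domain \<delta>' F"
    and Q: "prob_space Q"
    and S: "S \<in> borel_measurable Q" "one_sided_stable_law \<delta>' (distr Q borel S)"
    and K: "distributed Q lborel K (\<lambda>x. ennreal (K_density (\<delta> / \<delta>') x))"
    and SK_indep: "prob_space.indep_var Q borel S borel K"
    and d_pos: "\<And>k. 0 < d k" and d_incr: "incseq d" and d_lim: "filterlim d at_top sequentially"
    and U_lim: "converges_in_distribution M (\<lambda>k \<omega>. U k \<omega> / d k)
                  (distr Q borel (\<lambda>\<omega>. S \<omega> powr (- \<delta>') * K \<omega> powr (\<delta>' / \<delta>)))"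
  shows "(\<exists>(a :: nat \<Rightarrow> real) (b :: nat \<Rightarrow> real). (\<forall>k. 0 < b k) \<and>
            converges_in_distribution M (\<lambda>k \<omega>. (sample_min X (N k \<omega>) \<omega> - a k) / b k) \<mu>) \<and>
         ((\<forall>k. 0 < min_scale F (d k)) \<and>
          (\<forall>\<^sub>F k in sequentially. min_scale F (d k) < \<infinity>) \<and>
          converges_in_distribution M
            (\<lambda>k \<omega>. (sample_min X (N k \<omega>) \<omega> - real_of_ereal (lext F))
                     / real_of_ereal (min_scale F (d k))) \<mu>)"
proof -
  interpret M: prob_space M by fact
  interpret Q: prob_space Q by fact
  have X_meas: "X j \<in> borel_measurable M" for j
    using X_indep by (simp add: M.indep_vars_def)
  have N_meas: "N k \<in> measurable M (count_space UNIV)" for k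
    using N_indep[of k] by (simp add: independent_rvs_def)
  have K_meas: "K \<in> borel_measurable Q" using Q.indep_var_rv2[OF SK_indep] .
  note [measurable] = X_meas S(1) K_meas
  have \<mu>: "real_distribution \<mu>"
    using mu by (simp add: mittag_leffler_law_def nonneg_law_with_laplace_def)
  have "((\<lambda>s. 1 / (1 + s powr \<delta>)) \<longlongrightarrow> 0) at_top" using delta(1) by real_asymp
  then have \<mu>_pos: "AE x in \<mu>. 0 < x"
    using mu unfolding mittag_leffler_law_def by (intro nonneg_law_AE_pos)
  have d'_pos: "0 < \<delta>'" using delta(1) delta'(1) by simp
  have F_cdf: "F x = measure M (X 0 -` {..<x} \<inter> space M)" for x
    unfolding F[of x 0] by (rule arg_cong[of _ _ "measure M"]) auto
  have F_mono: "mono F"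
  proof (rule monoI)
    fix x y :: real assume "x \<le> y"
    then show "F x \<le> F y" unfolding F_cdf by (intro M.finite_measure_mono) auto
  qed
  obtain x0 where x0: "0 < F x0"
  proof -
    have "(\<lambda>n. measure M (X 0 -` {..<real n} \<inter> space M)) \<longlonglongrightarrow> measure M (\<Union>n. X 0 -` {..<real n} \<inter> space M)"
      by (intro M.finite_Lim_measure_incseq) (auto simp: incseq_def)
    also have "(\<Union>n. X 0 -` {..<real n} \<inter> space M) = space M"
      using reals_Archimedean2 by auto
    finally have "(\<lambda>n. F (real n)) \<longlonglongrightarrow> 1" unfolding F_cdf[symmetric] by (simp add: M.prob_space)
    then have "\<forall>\<^sub>F n in sequentially. 0 < F (real n)" by (rule order_tendstoD) simp
    then show ?thesis using that by (auto simp: eventually_sequentially)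
  qed
  define a where "a = real_of_ereal (lext F)"
  have a: "lext F = ereal a"
    unfolding a_def by (rule weibull_min_domain_lext_finite[OF F_domain x0])
  define b where "b k = real_of_ereal (min_scale F (d k))" for k
  have scale_pos: "0 < min_scale F (d k)" for k
    by (rule min_scale_pos[OF F_mono F_domain d'_pos a d_pos])
  have scale_le: "\<forall>\<^sub>F k in sequentially. min_scale F (d k) \<le> ereal 1"
    by (rule min_scale_eventually[OF F_mono F_domain d'_pos a d_pos d_lim zero_less_one])
  then have scale_fin: "\<forall>\<^sub>F k in sequentially. min_scale F (d k) < \<infinity>"
    by eventually_elim (auto intro: le_less_trans)
  have b_pos: "\<forall>\<^sub>F k in sequentially. 0 < b k"
    using scale_fin
  proof eventually_elim
    case (elim k)
    then show ?case using scale_pos[of k] by (cases "min_scale F (d k)") (auto simp: b_def)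
  qed
  define W where "W \<omega> = S \<omega> powr (- \<delta>') * K \<omega> powr (\<delta>' / \<delta>)" for \<omega>
  have W_meas: "W \<in> borel_measurable Q" unfolding W_def by measurable
  have F_nonneg: "0 \<le> F x" for x unfolding F_cdf by simp
  have lim_b: "(\<lambda>k. \<P>(\<omega> in M. \<forall>j<N k \<omega>. a + b k * x \<le> X j \<omega>)) \<longlonglongrightarrow> 1 - cdf \<mu> x"
    if x: "0 < x" for x
  proof -
    have "\<P>(\<omega> in M. \<forall>j<N k \<omega>. a + b k * x \<le> X j \<omega>)
        = (\<integral>\<omega>. exp (- (d k * F (a + b k * x) * (U k \<omega> / d k))) \<partial>M)" for k
      using prob_poisson_sample_ge[OF M P U_nonneg U_indep N X_indep F N_indep, of k "a + b k * x"]
        d_pos[of k] by (simp add: mult.commute)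
    moreover have "(\<lambda>k. \<integral>\<omega>. exp (- (d k * F (a + b k * x) * (U k \<omega> / d k))) \<partial>M)
        \<longlonglongrightarrow> (\<integral>\<omega>. exp (- (x powr \<delta>' * W \<omega>)) \<partial>Q)"
    proof (rule converges_in_distribution_exp[OF M Q W_meas])
      show "converges_in_distribution M (\<lambda>k \<omega>. U k \<omega> / d k) (distr Q borel W)"
        using U_lim unfolding W_def .
      show "0 \<le> U k \<omega> / d k" if "\<omega> \<in> space M" for k \<omega>
        using U_nonneg[OF that, of k] d_pos[of k] by simp
      show "(\<lambda>k. d k * F (a + b k * x)) \<longlonglongrightarrow> x powr \<delta>'"
        unfolding b_def by (rule min_scale_normalizes[OF F_mono F_domain d'_pos a d_pos d_lim x])
      show "0 \<le> d k * F (a + b k * x)" for k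
        using d_pos[of k] F_nonneg by simp
    qed
    moreover have "(\<integral>\<omega>. exp (- (x powr \<delta>' * W \<omega>)) \<partial>Q) = 1 - cdf \<mu> x"
      using mittag_leffler_cdf[OF delta(1) delta'(1) mu Q S(2) K SK_indep x]
      by (simp add: W_def)
    ultimately show ?thesis by simp
  qed
  have conv_b: "converges_in_distribution M (\<lambda>k \<omega>. (sample_min X (N k \<omega>) \<omega> - a) / b k) \<mu>"
    by (rule converges_in_distribution_sample_min[OF M \<mu> \<mu>_pos X_meas N_meas b_pos lim_b])
  \<comment> \<open>The scale is infinite, hence 0 as a real number, as long as d k \<le> 1; any positive value will do for these k.\<close>
  define b' where "b' k = (if 0 < b k then b k else 1)" for k
  have conv_b': "converges_in_distribution M (\<lambda>k \<omega>. (sample_min X (N k \<omega>) \<omega> - a) / b' k) \<mu>"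
  proof (rule converges_in_distribution_sample_min[OF M \<mu> \<mu>_pos X_meas N_meas])
    show "\<forall>\<^sub>F k in sequentially. 0 < b' k" by (simp add: b'_def)
    fix x :: real assume x: "0 < x"
    show "(\<lambda>k. \<P>(\<omega> in M. \<forall>j<N k \<omega>. a + b' k * x \<le> X j \<omega>)) \<longlonglongrightarrow> 1 - cdf \<mu> x"
      using lim_b[OF x]
      by (rule Lim_transform_eventually) (use b_pos in eventually_elim, simp add: b'_def)
  qed
  have "\<exists>(a :: nat \<Rightarrow> real) (b :: nat \<Rightarrow> real). (\<forall>k. 0 < b k) \<and>
            converges_in_distribution M (\<lambda>k \<omega>. (sample_min X (N k \<omega>) \<omega> - a k) / b k) \<mu>"
    using conv_b' by (intro exI[of _ "\<lambda>_. a"] exI[of _ b']) (simp add: b'_def)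
  then show ?thesis
    using scale_pos scale_fin conv_b unfolding a_def b_def by blast
qed

end
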